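(* Consider an instance of the unrooted traveling repairman problem in which time is divided into consecutive periods of length $1/2$ and every time window completely contains exactly three periods and partially overlaps the two neighboring periods. Let $s = q/r$ be a rational speedup with $17/7 \le s \le 3$. Then algorithm SPEEDUPW12, run at speed $s$, finds in $O(\min\{r,m\}\Gamma(n))$ time a service run $\hat R$ with $\mathrm{profit}(R^* )/\mathrm{profit}(\hat R) \le \gamma(23-7s)/(1+3s-s^2)$, where $R^*$ is an optimal service run at unit speed on the untrimmed windows.
   Context: Unrooted traveling repairman problem with time windows: the input is a metric weighted graph (travel distances on edges) and a list of service requests, each located at a node and having a time window $[w, w+k)$; a service run may start at any request at any time and travels at a given speed; its profit is the number of requests it visits during their time windows. Unit speed is a reference speed assumed no faster than the slowest speed at which some service run can visit all requests during their windows; $R^*$ denotes an optimal service run at unit speed; running at speedup $s$ means traveling $s$ times faster than unit speed. Trimming: time is divided into periods; each window is trimmed to one period it fully contains, so that trimmed windows are pairwise identical or disjoint. Algorithm SPEEDUPW12: for each period length $\alpha \in \{1/2, 3/4, 1\}$ and each starting offset of the period grid that is a multiple of $1/4$ (2, 3, or 4 offsets respectively), and for each choice of which fully contained period each window is trimmed to, it runs the subroutine SPEEDUP (the authors' earlier algorithm for equal-length trimmed windows at speedup $s$, which selects good paths inside periods and pastes them together by dynamic programming) and returns the most profitable run found. $\gamma$ is the approximation factor of the within-period maximum-profit path subroutine: $\gamma = 1$ for a tree and $\gamma \le 2+\epsilon$ for a metric graph, any constant $\epsilon>0$; $\Gamma(n)$ is its running time, $O(n^4)$ for a tree and $O(n^{O(1/\epsilon^2)})$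 for a metric graph; $m$ is the number of distinct periods. *)

theory Defs
  imports "HOL-Analysis.Abstract_Metric_Spaces" "HOL-Library.Monad_Syntax"
begin

text \<open>
  A metric weighted graph is a finite node set with a metric of travel distances; a tree is
  represented by its path metric.  An instance has a list of requests, so several requests may share
  a node and even a window, and \<open>n\<close> is the length of the list.
\<close>

datatype 'v request = Request (node: 'v) (win_start: real) (win_len: real)

definition window :: "'v request \<Rightarrow> real set" where
  "window x = {win_start x ..< win_start x + win_len x}"

definition metric_graph :: "'v set \<Rightarrow> ('v \<Rightarrow> 'v \<Rightarrow> real) \<Rightarrow> bool" where
  "metric_graph V d \<longleftrightarrow> finite V \<and> Metric_space V d"

text \<open>A run is the chronological list of its stops: a node together with a time.\<close>

type_synonym 'v run = "('v \<times> real) list"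

definition service_run ::
  "'v set \<Rightarrow> ('v \<Rightarrow> 'v \<Rightarrow> real) \<Rightarrow> 'v request list \<Rightarrow> real \<Rightarrow> 'v run \<Rightarrow> bool" where
  "service_run V d reqs s R \<longleftrightarrow>
     R \<noteq> [] \<and> fst (hd R) \<in> node ` set reqs \<and> fst ` set R \<subseteq> V \<and>
     successively (\<lambda>(u, t) (v, t'). t \<le> t' \<and> d u v \<le> s * (t' - t)) R"

definition served :: "'v run \<Rightarrow> 'v request \<Rightarrow> bool" where
  "served R x \<longleftrightarrow> (\<exists>t \<in> window x. (node x, t) \<in> set R)"

definition profit :: "'v request list \<Rightarrow> 'v run \<Rightarrow> nat" where
  "profit reqs R = length (filter (served R) reqs)"

definition optimal_run ::
  "'v set \<Rightarrow> ('v \<Rightarrow> 'v \<Rightarrow> real) \<Rightarrow> 'v request list \<Rightarrow> real \<Rightarrow> 'v run \<Rightarrow> bool" where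
  "optimal_run V d reqs s R \<longleftrightarrow>
     service_run V d reqs s R \<and> (\<forall>R'. service_run V d reqs s R' \<longrightarrow> profit reqs R' \<le> profit reqs R)"

text \<open>
  Unit speed is the reference speed: no run that is slower than unit speed visits all requests during
  their windows.
\<close>

definition unit_speed_is_reference ::
  "'v set \<Rightarrow> ('v \<Rightarrow> 'v \<Rightarrow> real) \<Rightarrow> 'v request list \<Rightarrow> bool" where
  "unit_speed_is_reference V d reqs \<longleftrightarrow>
     (\<forall>\<sigma>>0. (\<exists>R. service_run V d reqs \<sigma> R \<and> (\<forall>x \<in> set reqs. served R x)) \<longrightarrow> 1 \<le> \<sigma>)"

definition period :: "real \<Rightarrow> real \<Rightarrow> int \<Rightarrow> real set" where
  "period \<alpha> \<delta> i = {\<delta> + of_int i * \<alpha> ..< \<delta> + (of_int i + 1) * \<alpha>}"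

definition partially_overlaps :: "real set \<Rightarrow> real set \<Rightarrow> bool" where
  "partially_overlaps W P \<longleftrightarrow> W \<inter> P \<noteq> {} \<and> \<not> P \<subseteq> W"

definition three_full_periods :: "real \<Rightarrow> real \<Rightarrow> 'v request \<Rightarrow> bool" where
  "three_full_periods \<alpha> \<delta> x \<longleftrightarrow>
     (\<exists>a. {i. period \<alpha> \<delta> i \<subseteq> window x} = {a, a + 1, a + 2} \<and>
          partially_overlaps (window x) (period \<alpha> \<delta> (a - 1)) \<and>
          partially_overlaps (window x) (period \<alpha> \<delta> (a + 3)))"

definition first_full_period :: "real \<Rightarrow> real \<Rightarrow> 'v request \<Rightarrow> int" where
  "first_full_period \<alpha> \<delta> x = \<lceil>(win_start x - \<delta>) / \<alpha>\<rceil>"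

definition num_full_periods :: "real \<Rightarrow> real \<Rightarrow> 'v request \<Rightarrow> nat" where
  "num_full_periods \<alpha> \<delta> x =
     nat (\<lfloor>(win_start x + win_len x - \<delta>) / \<alpha>\<rfloor> - first_full_period \<alpha> \<delta> x)"

lemma period_subset_window_iff:
  assumes "\<alpha> > 0"
  shows "period \<alpha> \<delta> i \<subseteq> window x \<longleftrightarrow>
    first_full_period \<alpha> \<delta> x \<le> i \<and> i < first_full_period \<alpha> \<delta> x + int (num_full_periods \<alpha> \<delta> x)"
proof -
  have "period \<alpha> \<delta> i \<subseteq> window x \<longleftrightarrow>
      win_start x \<le> \<delta> + of_int i * \<alpha> \<and> \<delta> + (of_int i + 1) * \<alpha> \<le> win_start x + win_len x"
    using assms by (simp add: period_def window_def atLeastLessThan_subset_iff algebra_simps)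
  also have "win_start x \<le> \<delta> + of_int i * \<alpha> \<longleftrightarrow> first_full_period \<alpha> \<delta> x \<le> i"
    using assms by (simp add: first_full_period_def ceiling_le_iff field_simps)
  also have "\<delta> + (of_int i + 1) * \<alpha> \<le> win_start x + win_len x \<longleftrightarrow>
      i + 1 \<le> \<lfloor>(win_start x + win_len x - \<delta>) / \<alpha>\<rfloor>"
    using assms by (simp add: le_floor_iff field_simps)
  finally show ?thesis
    by (auto simp: num_full_periods_def)
qed

text \<open>
  A choice of trimming \<open>c\<close> fixes, for every number \<open>k\<close> of fully contained periods, which of them (in
  chronological order, counted from \<open>0\<close>) a window that contains \<open>k\<close> periods is trimmed to, namely
  \<open>c ! (k - 1)\<close>.  A window of length at most \<open>2\<close> contains at most four periods of length
  at least \<open>1/2\<close>.  A window that contains no full period of a grid is dropped on that grid.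
\<close>

definition trim_choices :: "nat list list" where
  "trim_choices = product_lists [[0], [0, 1], [0, 1, 2], [0, 1, 2, 3]]"

definition trimmed_period :: "real \<Rightarrow> real \<Rightarrow> nat list \<Rightarrow> 'v request \<Rightarrow> int option" where
  "trimmed_period \<alpha> \<delta> c x =
     (let k = num_full_periods \<alpha> \<delta> x
      in if k = 0 then None
         else Some (first_full_period \<alpha> \<delta> x + int (if k \<le> length c then c ! (k - 1) else 0)))"

definition num_periods :: "real \<Rightarrow> real \<Rightarrow> nat list \<Rightarrow> 'v request list \<Rightarrow> nat" where
  "num_periods \<alpha> \<delta> c reqs = card {i. \<exists>x \<in> set reqs. trimmed_period \<alpha> \<delta> c x = Some i}"

definition period_grids :: "(real \<times> real) list" where
  "period_grids =
     [(1/2, 0), (1/2, 1/4),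
      (3/4, 0), (3/4, 1/4), (3/4, 1/2),
      (1, 0), (1, 1/4), (1, 1/2), (1, 3/4)]"

text \<open>
  A timed value carries the number of steps spent on it: on a machine with random access memory and
  unit-cost real arithmetic, each step stands for a constant amount of work.  Every
  iteration of a loop costs one step; work that is not constant and not in a loop is charged
  explicitly.
\<close>

type_synonym 'a timed = "'a \<times> nat"

definition ret :: "'a \<Rightarrow> 'a timed" where
  "ret x = (x, 0)"

definition bind_timed :: "'a timed \<Rightarrow> ('a \<Rightarrow> 'b timed) \<Rightarrow> 'b timed" where
  "bind_timed x f = (fst (f (fst x)), snd x + snd (f (fst x)))"

adhoc_overloading Monad_Syntax.bind \<rightleftharpoons> bind_timed

definition charge :: "nat \<Rightarrow> unit timed" where
  "charge k = ((), k)"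

fun loop :: "('a \<Rightarrow> 'b \<Rightarrow> 'b timed) \<Rightarrow> 'a list \<Rightarrow> 'b \<Rightarrow> 'b timed" where
  "loop f [] y = ret y"
| "loop f (x # xs) y = do { charge 1; y' \<leftarrow> f x y; loop f xs y' }"

fun path_length :: "('v \<Rightarrow> 'v \<Rightarrow> real) \<Rightarrow> 'v list \<Rightarrow> real" where
  "path_length d (u # v # vs) = d u v + path_length d (v # vs)"
| "path_length d _ = 0"

text \<open>
  Requests are referred to by their indices; \<open>loc i\<close> is the node of request \<open>i\<close>.  A path
  inside a period visits requests from a given set \<open>S\<close>, and its profit is its number of requests.
\<close>

definition path_between :: "nat set \<Rightarrow> nat \<Rightarrow> nat \<Rightarrow> nat list \<Rightarrow> bool" where
  "path_between S i j p \<longleftrightarrow> p \<noteq> [] \<and> distinct p \<and> set p \<subseteq> S \<and> hd p = i \<and> last p = j"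

text \<open>
  For each pair of end points the subroutine returns at most \<open>|S|\<close> paths (at most one for each value
  of the profit), among which there is, for each length budget \<open>B\<close>, a path within the budget
  whose profit is at least the maximum divided by \<open>\<gamma>\<close>.
\<close>

definition max_profit_paths ::
  "real \<Rightarrow> ('v \<Rightarrow> 'v \<Rightarrow> real) \<Rightarrow> (nat \<Rightarrow> 'v) \<Rightarrow> nat set \<Rightarrow> (nat \<Rightarrow> nat \<Rightarrow> nat list list) \<Rightarrow> bool" where
  "max_profit_paths \<gamma> d loc S paths \<longleftrightarrow>
     (\<forall>i \<in> S. \<forall>j \<in> S.
        length (paths i j) \<le> card S \<and>
        (\<forall>p \<in> set (paths i j). path_between S i j p) \<and>
        (\<forall>B p. path_between S i j p \<and> path_length d (map loc p) \<le> B \<longrightarrow>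
           (\<exists>p' \<in> set (paths i j).
              path_length d (map loc p') \<le> B \<and> real (length p) \<le> \<gamma> * real (length p'))))"

type_synonym 'v subroutine =
  "'v set \<Rightarrow> ('v \<Rightarrow> 'v \<Rightarrow> real) \<Rightarrow> (nat \<Rightarrow> 'v) \<Rightarrow> nat list \<Rightarrow> (nat \<Rightarrow> nat \<Rightarrow> nat list list) timed"

text \<open>
  The subroutine need only work on a class \<open>\<N>\<close> of networks, such as the trees or all metric graphs.
  Its running time \<open>\<Gamma>\<close> is \<open>n\<^sup>4\<close> for trees and a polynomial of larger degree for metric
  graphs, up to constant factors; both are superadditive and at least \<open>n\<^sup>4\<close>.
\<close>

definition path_subroutine ::
  "('v set \<times> ('v \<Rightarrow> 'v \<Rightarrow> real)) set \<Rightarrow> real \<Rightarrow> (nat \<Rightarrow> nat) \<Rightarrow> 'v subroutine \<Rightarrow> bool" where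
  "path_subroutine \<N> \<gamma> \<Gamma> sub \<longleftrightarrow>
     (\<forall>(V, d) \<in> \<N>. \<forall>loc S. distinct S \<and> loc ` set S \<subseteq> V \<longrightarrow>
        max_profit_paths \<gamma> d loc (set S) (fst (sub V d loc S)) \<and>
        snd (sub V d loc S) \<le> \<Gamma> (length S))"

definition running_time_bound :: "(nat \<Rightarrow> nat) \<Rightarrow> bool" where
  "running_time_bound \<Gamma> \<longleftrightarrow> (\<forall>n. n ^ 4 \<le> \<Gamma> n) \<and> (\<forall>a b. \<Gamma> a + \<Gamma> b \<le> \<Gamma> (a + b))"

text \<open>
  A partial run is a list of the paths it follows, latest path first, each with the time at which
  it is entered.  The table of the dynamic program maps a last request \<open>j\<close> and a profit \<open>P\<close> to the
  earliest time at which a partial run with profit \<open>P\<close> can be at \<open>j\<close>, and to such a run.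
\<close>

type_synonym partial_run = "(real \<times> nat list) list"
type_synonym entry = "(real \<times> partial_run) option"
type_synonym dp_table = "nat \<Rightarrow> nat \<Rightarrow> entry"

fun earlier :: "entry \<Rightarrow> entry \<Rightarrow> entry" where
  "earlier None e = e"
| "earlier e None = e"
| "earlier (Some (t, R)) (Some (t', R')) = (if t' < t then Some (t', R') else Some (t, R))"

text \<open>
  Earliest arrival at request \<open>i\<close> with profit \<open>P\<close>, coming from the end \<open>j\<close> of a partial run through
  earlier periods, or starting the run at \<open>i\<close> at the beginning \<open>T\<close> of the period.
\<close>

definition arrival ::
  "('v \<Rightarrow> 'v \<Rightarrow> real) \<Rightarrow> real \<Rightarrow> (nat \<Rightarrow> 'v) \<Rightarrow> nat list \<Rightarrow> dp_table \<Rightarrow> real \<Rightarrow> nat \<Rightarrow> nat \<Rightarrow> entry timed" where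
  "arrival d s loc done_reqs D T i P =
     loop (\<lambda>j e. ret (earlier e (map_option (\<lambda>(t, R). (t + d (loc j) (loc i) / s, R)) (D j P))))
       done_reqs (if P = 0 then Some (T, []) else None)"

text \<open>
  Append the path \<open>p\<close> of length \<open>L\<close>, entered no earlier than the beginning \<open>T\<close> of its period, provided
  that it is completed before the end \<open>T + \<alpha>\<close> of the period.
\<close>

definition append_path :: "real \<Rightarrow> real \<Rightarrow> real \<Rightarrow> real \<Rightarrow> nat list \<Rightarrow> entry \<Rightarrow> entry" where
  "append_path s \<alpha> T L p e =
     (case e of
        None \<Rightarrow> None
      | Some (t, R) \<Rightarrow>
          (let b = max T t in if b + L / s < T + \<alpha> then Some (b + L / s, (b, p) # R) else None))"

definition update :: "dp_table \<Rightarrow> nat \<Rightarrow> nat \<Rightarrow> entry \<Rightarrow> dp_table" where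
  "update D j P e = D(j := (D j)(P := earlier (D j P) e))"

definition process_period ::
  "'v subroutine \<Rightarrow> 'v set \<Rightarrow> ('v \<Rightarrow> 'v \<Rightarrow> real) \<Rightarrow> real \<Rightarrow> (nat \<Rightarrow> 'v) \<Rightarrow> nat \<Rightarrow> real \<Rightarrow> real \<Rightarrow>
   int \<times> nat list \<Rightarrow> nat list \<times> dp_table \<Rightarrow> (nat list \<times> dp_table) timed" where
  "process_period sub V d s loc n \<alpha> \<delta> = (\<lambda>(k, S) (done_reqs, D).
     let T = \<delta> + of_int k * \<alpha> in do {
       paths \<leftarrow> sub V d loc S;
       D' \<leftarrow> loop (\<lambda>i D1. do {
           arr \<leftarrow> loop (\<lambda>P arr. do {
               e \<leftarrow> arrival d s loc done_reqs D T i P;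
               ret (arr(P := e)) }) [0..<Suc n] (\<lambda>_. None);
           loop (\<lambda>j D2.
             loop (\<lambda>p D3. do {
                 charge (length p);
                 let L = path_length d (map loc p);
                 loop (\<lambda>P D4. ret (update D4 j (P + length p) (append_path s \<alpha> T L p (arr P))))
                   [0..<Suc n] D3 }) (paths i j) D2) S D1 }) S D;
       charge (length S);
       ret (S @ done_reqs, D') })"

fun insert_request :: "int \<Rightarrow> nat \<Rightarrow> (int \<times> nat list) list \<Rightarrow> (int \<times> nat list) list timed" where
  "insert_request k i [] = do { charge 1; ret [(k, [i])] }"
| "insert_request k i ((k', S) # gs) = do {
     charge 1;
     if k < k' then ret ((k, [i]) # (k', S) # gs)
     else if k = k' then ret ((k', i # S) # gs)
     else do { gs' \<leftarrow> insert_request k i gs; ret ((k', S) # gs') } }"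

definition group_requests ::
  "real \<Rightarrow> real \<Rightarrow> nat list \<Rightarrow> 'v request list \<Rightarrow> (int \<times> nat list) list timed" where
  "group_requests \<alpha> \<delta> c reqs =
     loop (\<lambda>i gs. case trimmed_period \<alpha> \<delta> c (reqs ! i) of
         None \<Rightarrow> ret gs
       | Some k \<Rightarrow> insert_request k i gs) [0..<length reqs] []"

fun path_stops :: "('v \<Rightarrow> 'v \<Rightarrow> real) \<Rightarrow> real \<Rightarrow> real \<Rightarrow> 'v list \<Rightarrow> 'v run" where
  "path_stops d s t (u # v # vs) = (u, t) # path_stops d s (t + d u v / s) (v # vs)"
| "path_stops d s t [u] = [(u, t)]"
| "path_stops d s t [] = []"

definition stops :: "('v \<Rightarrow> 'v \<Rightarrow> real) \<Rightarrow> real \<Rightarrow> (nat \<Rightarrow> 'v) \<Rightarrow> partial_run \<Rightarrow> 'v run timed" where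
  "stops d s loc R =
     loop (\<lambda>(t, p) stps. do {
         charge (length p);
         ret (path_stops d s t (map loc p) @ stps) }) R []"

text \<open>The empty list is returned if every window is dropped by the trimming.\<close>

definition speedup ::
  "'v subroutine \<Rightarrow> 'v set \<Rightarrow> ('v \<Rightarrow> 'v \<Rightarrow> real) \<Rightarrow> real \<Rightarrow> 'v request list \<Rightarrow>
   real \<Rightarrow> real \<Rightarrow> nat list \<Rightarrow> 'v run timed" where
  "speedup sub V d s reqs \<alpha> \<delta> c = (let n = length reqs; loc = (\<lambda>i. node (reqs ! i)) in do {
     groups \<leftarrow> group_requests \<alpha> \<delta> c reqs;
     (done_reqs, D) \<leftarrow> loop (process_period sub V d s loc n \<alpha> \<delta>) groups ([], \<lambda>_ _. None);
     best \<leftarrow> loop (\<lambda>P R.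
         loop (\<lambda>j R. ret (case D j P of None \<Rightarrow> R | Some (_, R') \<Rightarrow> R')) done_reqs R)
       [0..<Suc n] [];
     stops d s loc best })"

definition better_run :: "'v request list \<Rightarrow> 'v run \<Rightarrow> 'v run \<Rightarrow> 'v run timed" where
  "better_run reqs R R' = do {
     charge (length reqs * (length R + length R'));
     ret (if profit reqs R < profit reqs R' then R' else R) }"

definition speedupw12 ::
  "'v subroutine \<Rightarrow> 'v set \<Rightarrow> ('v \<Rightarrow> 'v \<Rightarrow> real) \<Rightarrow> real \<Rightarrow> 'v request list \<Rightarrow> 'v run timed" where
  "speedupw12 sub V d s reqs =
     loop (\<lambda>(\<alpha>, \<delta>) best.
       loop (\<lambda>c best. do {
           R \<leftarrow> speedup sub V d s reqs \<alpha> \<delta> c;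
           better_run reqs best R }) trim_choices best) period_grids []"

end

theory Submission
  imports Defs
begin

text \<open>
  For \<open>17/7 \<le> s \<le> 3\<close> the claimed ratio is at least \<open>2 * \<gamma>\<close>, and two runs derived from \<open>R\<^sup>*\<close> on the
  grid with \<open>\<alpha> = 1\<close> and the same offset suffice for this.  A window that contains exactly
  three periods of length \<open>1/2\<close> contains a full period \<open>[T, T + 1)\<close> of this grid and lies in
  \<open>[T - 1, T + 2)\<close>.  In every period a run at speed \<open>2\<close> can repeat either what \<open>R\<^sup>*\<close> does during
  \<open>[T - 1, T + 1/2)\<close> or what it does during \<open>[T + 1/2, T + 2)\<close>, and go back in time for the next
  period; one of these two runs serves at least half of the requests served by \<open>R\<^sup>*\<close>.
  The dynamic program loses only the factor \<open>\<gamma>\<close> against any run that serves requests in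
  the periods they are trimmed to, and its number of steps is \<open>O(n\<^sup>4 + \<Gamma>(n)) = O(\<Gamma>(n))\<close>.
\<close>

section \<open>Timed loops\<close>

text \<open>The claimed ratio equals \<open>2 * \<gamma>\<close> at \<open>s = 3\<close> and exceeds
  it below, so speed 2 is all that the comparison runs use. In a period of length 1, speed 2 gives a
  travel budget of 2: 3/2 forward and 1/2 back. Two stretches of length 3/2 cover the interval of
  length 3 in which a window lies. Each of the two runs is compared with the same output of the
  dynamic program, so it need not be known which of them is better. The obstacle is that the table
  keeps one earliest time per last request and profit, while the subroutine replaces the paths of
  the comparison run by its own. What survives is a single request of that run, reached no later
  than there, with a profit of at least the fraction \<open>1 / \<gamma>\<close> of the requests
  passed so far. Profits and losses of the periods add up, so the factor \<open>\<gamma>\<close>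
  does not compound. For the time, \<open>min r m\<close> is at least 1, and a bound by a multiple
  of \<open>\<Gamma> n\<close> is enough; the numerical constants are sums of coefficients, partly
  rounded up.\<close>

lemma fst_bind [simp]: "fst (bind_timed x f) = fst (f (fst x))"
  and snd_bind [simp]: "snd (bind_timed x f) = snd x + snd (f (fst x))"
  by (simp_all add: bind_timed_def)

lemma fst_ret [simp]: "fst (ret x) = x" and snd_ret [simp]: "snd (ret x) = 0"
  by (simp_all add: ret_def)

lemma snd_charge [simp]: "snd (charge k) = k"
  by (simp add: charge_def)

lemma fst_loop [simp]: "fst (loop f xs y) = fold (\<lambda>x y. fst (f x y)) xs y"
  by (induction xs arbitrary: y) auto

text \<open>The cost of an iteration may depend on the accumulator, for instance on the length of
  the best run so far, so \<open>b\<close> is required only under \<open>I\<close>. The added 1 is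
  the loop's own charge.\<close>

lemma snd_loop_invariant:
  assumes "I y"
    and "\<And>x y. x \<in> set xs \<Longrightarrow> I y \<Longrightarrow> I (fst (f x y)) \<and> snd (f x y) \<le> b"
  shows "snd (loop f xs y) \<le> length xs * (1 + b)"
  using assms
proof (induction xs arbitrary: y)
  case (Cons x xs)
  have "snd (f x y) \<le> b" "I (fst (f x y))"
    using Cons.prems by auto
  moreover from this have "snd (loop f xs (fst (f x y))) \<le> length xs * (1 + b)"
    using Cons.prems by (intro Cons.IH) auto
  ultimately show ?case
    by simp
qed simp

lemma snd_loop_le:
  assumes "\<And>x y. x \<in> set xs \<Longrightarrow> snd (f x y) \<le> b"
  shows "snd (loop f xs y) \<le> length xs * (1 + b)"
  using assms by (intro snd_loop_invariant[where I = "\<lambda>_. True"]) auto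

text \<open>The tool for optimality: the iteration at \<open>x\<close> establishes \<open>Q\<close>
  whatever came before, and the iterations after it cannot destroy it.\<close>

lemma fold_reaches:
  assumes "x \<in> set xs" "\<And>y. Q (f x y)" "\<And>x y. x \<in> set xs \<Longrightarrow> Q y \<Longrightarrow> Q (f x y)"
  shows "Q (fold f xs y)"
proof -
  obtain ys zs where xs: "xs = ys @ x # zs"
    using assms(1) by (meson split_list)
  show ?thesis
    unfolding xs using assms
    by (auto simp: xs intro!: fold_invariant[where Q = "\<lambda>x. x \<in> set zs" and P = Q])
qed

lemma fold_preserves:
  assumes "Q y" "\<And>x y. x \<in> set xs \<Longrightarrow> Q y \<Longrightarrow> Q (f x y)"
  shows "Q (fold f xs y)"
  by (rule fold_invariant[where Q = "\<lambda>x. x \<in> set xs"]) (use assms in auto)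

section \<open>Grouping requests by period\<close>

text \<open>Strict sorting gives each period one group and lets the program move forward in time.
  Since no group is empty, there are at most as many groups as requests.\<close>

definition grouped :: "(nat \<Rightarrow> int option) \<Rightarrow> nat set \<Rightarrow> (int \<times> nat list) list \<Rightarrow> bool" where
  "grouped tr A gs \<longleftrightarrow>
     sorted_wrt (<) (map fst gs) \<and>
     (\<forall>(k, S) \<in> set gs. S \<noteq> [] \<and> distinct S \<and> (\<forall>i \<in> set S. tr i = Some k)) \<and>
     (\<Union>(k, S) \<in> set gs. set S) = A"

lemma grouped_Cons:
  "grouped tr A ((k, S) # gs) \<longleftrightarrow>
     (\<exists>B. grouped tr B gs \<and> A = set S \<union> B \<and> (\<forall>k' \<in> fst ` set gs. k < k') \<and>
          S \<noteq> [] \<and> distinct S \<and> (\<forall>i \<in> set S. tr i = Some k))"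
  unfolding grouped_def by auto

lemma fst_insert_request:
  "fst ` set (fst (insert_request k i gs)) = insert k (fst ` set gs)"
  by (induction k i gs rule: insert_request.induct) auto

lemma grouped_insert_request:
  assumes "grouped tr A gs" "i \<notin> A" "tr i = Some k"
  shows "grouped tr (insert i A) (fst (insert_request k i gs))"
  using assms
proof (induction k i gs arbitrary: A rule: insert_request.induct)
  case (1 k i)
  then show ?case
    by (auto simp: grouped_def)
next
  case (2 k i k' S gs)
  obtain B where B: "grouped tr B gs" "A = set S \<union> B" "\<forall>l \<in> fst ` set gs. k' < l"
      "S \<noteq> []" "distinct S" "\<forall>i \<in> set S. tr i = Some k'"
    using 2(2) unfolding grouped_Cons by auto
  consider "k < k'" | "k = k'" | "k' < k"
    by linarith
  then show ?case
  proof cases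
    case 1
    have "grouped tr (set [i] \<union> A) ((k, [i]) # (k', S) # gs)"
      unfolding grouped_Cons[of _ _ k] using 2(2) 2(4) 1 B by fastforce
    then show ?thesis
      using 1 by simp
  next
    case 2
    have "grouped tr (set (i # S) \<union> B) ((k', i # S) # gs)"
      unfolding grouped_Cons using B 2 \<open>i \<notin> A\<close> \<open>tr i = Some k\<close> by fastforce
    then show ?thesis
      using 2 B by simp
  next
    case 3
    have "grouped tr (insert i B) (fst (insert_request k i gs))"
      using 3 2 B by auto
    then have "grouped tr (set S \<union> insert i B) ((k', S) # fst (insert_request k i gs))"
      unfolding grouped_Cons using B 3 by (auto simp: fst_insert_request)
    then show ?thesis
      using 3 B by simp
  qed
qed

lemma snd_insert_request: "snd (insert_request k i gs) \<le> Suc (length gs)"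
  by (induction k i gs rule: insert_request.induct) auto

text \<open>Distinct groups are disjoint because \<open>tr\<close> assigns a request to only one
  period, so their lengths add up to the cardinality.\<close>

lemma length_groups_le:
  assumes "grouped tr A gs" "finite A"
  shows "(\<Sum>(k, S)\<leftarrow>gs. length S) = card A" "length gs \<le> card A"
proof -
  have "(\<Sum>(k, S)\<leftarrow>gs. length S) = card A \<and> length gs \<le> card A"
    using assms
  proof (induction gs arbitrary: A)
    case Nil
    then show ?case by (auto simp: grouped_def)
  next
    case (Cons g gs)
    obtain k S where g: "g = (k, S)" by fastforce
    obtain B where B: "grouped tr B gs" "A = set S \<union> B" "\<forall>k' \<in> fst ` set gs. k < k'"
        "S \<noteq> []" "distinct S" "\<forall>i \<in> set S. tr i = Some k"
      using Cons.prems(1) unfolding g grouped_Cons by auto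
    have "set S \<inter> B = {}"
      using B(1,3,6) by (fastforce simp: grouped_def)
    then have "card A = length S + card B"
      using B Cons.prems by (auto simp: card_Un_disjoint distinct_card)
    moreover have "length S \<ge> 1"
      using B(4) by (cases S) auto
    ultimately show ?case
      using Cons.IH[OF B(1)] B(2) Cons.prems(2) g by auto
  qed
  then show "(\<Sum>(k, S)\<leftarrow>gs. length S) = card A" "length gs \<le> card A"
    by auto
qed

lemma grouped_group_requests:
  fixes reqs :: "'v request list" and \<alpha> \<delta> :: real and c :: "nat list"
  defines "tr \<equiv> \<lambda>i. trimmed_period \<alpha> \<delta> c (reqs ! i)"
  shows "grouped tr {i. i < length reqs \<and> tr i \<noteq> None} (fst (group_requests \<alpha> \<delta> c reqs))"
    and "snd (group_requests \<alpha> \<delta> c reqs) \<le> length reqs * (2 + length reqs)"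
proof -
  let ?f = "\<lambda>i gs. case trimmed_period \<alpha> \<delta> c (reqs ! i) of
              None \<Rightarrow> ret gs | Some k \<Rightarrow> insert_request k i gs"
  have *: "grouped tr {i. i < m \<and> tr i \<noteq> None} (fst (loop ?f [0..<m] [])) \<and>
      snd (loop ?f [0..<m] []) \<le> m * (2 + length reqs)" if "m \<le> length reqs" for m
    using that
  proof (induction m)
    case 0
    then show ?case by (auto simp: grouped_def)
  next
    case (Suc m)
    let ?gs = "fst (loop ?f [0..<m] [])"
    have IH: "grouped tr {i. i < m \<and> tr i \<noteq> None} ?gs"
        "snd (loop ?f [0..<m] []) \<le> m * (2 + length reqs)"
      using Suc by auto
    have loop_append: "snd (loop f (xs @ [x]) y) = snd (loop f xs y) + 1 + snd (f x (fst (loop f xs y)))"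
      for f :: "nat \<Rightarrow> (int \<times> nat list) list \<Rightarrow> (int \<times> nat list) list timed" and xs x y
      by (induction xs arbitrary: y) auto
    \<comment> \<open>At most \<open>m\<close> requests have been inserted and no group is empty, so
      the next insertion costs at most \<open>Suc m\<close>.\<close>
    have "length ?gs \<le> card {i. i < m \<and> tr i \<noteq> None}"
      using length_groups_le[OF IH(1)] by auto
    also have "\<dots> \<le> m"
      using card_mono[of "{..<m}" "{i. i < m \<and> tr i \<noteq> None}"] by auto
    finally have "Suc (length ?gs) \<le> Suc m" by simp
    then have cost: "snd (?f m ?gs) \<le> length reqs"
      using Suc.prems order_trans[OF snd_insert_request[of _ m ?gs]]
      by (auto split: option.split)
    have "grouped tr {i. i < Suc m \<and> tr i \<noteq> None} (fst (?f m ?gs))"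
    proof (cases "tr m")
      case None
      then have "{i. i < Suc m \<and> tr i \<noteq> None} = {i. i < m \<and> tr i \<noteq> None}"
        by (auto simp: less_Suc_eq)
      then show ?thesis
        using None IH(1) by (simp add: tr_def)
    next
      case (Some k)
      then have "{i. i < Suc m \<and> tr i \<noteq> None} = insert m {i. i < m \<and> tr i \<noteq> None}"
        by (auto simp: less_Suc_eq)
      moreover have "grouped tr (insert m {i. i < m \<and> tr i \<noteq> None}) (fst (insert_request k m ?gs))"
        using IH(1) Some by (intro grouped_insert_request) auto
      ultimately show ?thesis
        using Some by (simp add: tr_def)
    qed
    moreover have "fst (loop ?f [0..<Suc m] []) = fst (?f m ?gs)"
    proof -
      have "fst (loop f [0..<Suc m] []) = fst (f m (fst (loop f [0..<m] [])))"
        for f :: "nat \<Rightarrow> (int \<times> nat list) list \<Rightarrow> (int \<times> nat list) list timed"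
        by simp
      then show ?thesis .
    qed
    moreover have "snd (loop ?f [0..<Suc m] []) \<le> Suc m * (2 + length reqs)"
      using IH(2) cost loop_append[of ?f "[0..<m]" m "[]"] by simp
    ultimately show ?case
      by simp
  qed
  show "grouped tr {i. i < length reqs \<and> tr i \<noteq> None} (fst (group_requests \<alpha> \<delta> c reqs))"
    "snd (group_requests \<alpha> \<delta> c reqs) \<le> length reqs * (2 + length reqs)"
    using *[of "length reqs"] unfolding group_requests_def by auto
qed

section \<open>Runs built from partial runs\<close>

definition run_step :: "('v \<Rightarrow> 'v \<Rightarrow> real) \<Rightarrow> real \<Rightarrow> 'v \<times> real \<Rightarrow> 'v \<times> real \<Rightarrow> bool" where
  "run_step d s = (\<lambda>(u, t) (v, t'). t \<le> t' \<and> d u v \<le> s * (t' - t))"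

definition run_of :: "('v \<Rightarrow> 'v \<Rightarrow> real) \<Rightarrow> real \<Rightarrow> (nat \<Rightarrow> 'v) \<Rightarrow> partial_run \<Rightarrow> 'v run" where
  "run_of d s loc R = fst (stops d s loc R)"

lemma run_of_Nil [simp]: "run_of d s loc [] = []"
  by (simp add: run_of_def stops_def)

text \<open>A partial run lists its latest path first and the fold puts every further path in front,
  which restores chronological order. The induction needs an arbitrary accumulator.\<close>

lemma run_of_Cons [simp]:
  "run_of d s loc ((b, p) # R) = run_of d s loc R @ path_stops d s b (map loc p)"
proof -
  have "fold (\<lambda>(t, p) stps. path_stops d s t (map loc p) @ stps) R acc =
      fold (\<lambda>(t, p) stps. path_stops d s t (map loc p) @ stps) R [] @ acc" for acc
  proof (induction R rule: rev_induct)
    case (snoc x R)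
    then show ?case
      by (auto split: prod.split)
  qed simp
  from this[of "path_stops d s b (map loc p)"] show ?thesis
    by (simp add: run_of_def stops_def case_prod_unfold)
qed

lemma path_stops_Nil_iff [simp]: "path_stops d s t vs = [] \<longleftrightarrow> vs = []"
  by (induction vs rule: induct_list012) auto

lemma length_path_stops [simp]: "length (path_stops d s t vs) = length vs"
  by (induction d s t vs rule: path_stops.induct) auto

lemma fst_path_stops: "map fst (path_stops d s t vs) = vs"
  by (induction d s t vs rule: path_stops.induct) auto

lemma hd_path_stops: "vs \<noteq> [] \<Longrightarrow> hd (path_stops d s t vs) = (hd vs, t)"
  by (induction vs rule: induct_list012) auto

lemma last_path_stops:
  "vs \<noteq> [] \<Longrightarrow> last (path_stops d s t vs) = (last vs, t + path_length d vs / s)"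
  by (induction d s t vs rule: path_stops.induct) (auto simp: add_divide_distrib)

lemma path_length_nonneg:
  assumes "\<And>u v. 0 \<le> d u v"
  shows "0 \<le> path_length d vs"
  using assms by (induction d vs rule: path_length.induct) auto

lemma successively_path_stops:
  assumes "\<And>u v. 0 \<le> d u v" "s > 0"
  shows "successively (run_step d s) (path_stops d s t vs)"
  using assms
proof (induction d s t vs rule: path_stops.induct)
  case (1 d s t u v vs)
  then show ?case
    by (auto simp: successively_Cons hd_path_stops run_step_def)
qed auto

lemma path_stops_times:
  assumes "\<And>u v. 0 \<le> d u v" "s > 0" "v \<in> set vs"
  shows "\<exists>t'. t \<le> t' \<and> t' \<le> t + path_length d vs / s \<and> (v, t') \<in> set (path_stops d s t vs)"
  using assms
proof (induction d s t vs rule: path_stops.induct)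
  case (1 d s t u w vs)
  have nonneg: "0 \<le> path_length d (w # vs)" "0 \<le> d u w"
    using 1(2) path_length_nonneg by auto
  show ?case
  proof (cases "v \<in> set (w # vs)")
    case True
    then obtain t' where t': "t + d u w / s \<le> t'" "t' \<le> t + d u w / s + path_length d (w # vs) / s"
        "(v, t') \<in> set (path_stops d s (t + d u w / s) (w # vs))"
      using 1 by auto
    have "0 \<le> d u w / s"
      using nonneg \<open>s > 0\<close> by simp
    then show ?thesis
      using t' by (intro exI[of _ t']) (auto simp: add_divide_distrib)
  next
    case False
    then show ?thesis
      using 1(3,4) nonneg by (intro exI[of _ t]) auto
  qed
qed (use path_length_nonneg in auto)

definition requests_of :: "partial_run \<Rightarrow> nat list" where
  "requests_of R = concat (map snd R)"

lemma length_run_of: "length (run_of d s loc R) = length (requests_of R)"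
  by (induction R) (auto simp: requests_of_def)

lemma snd_stops: "snd (stops d s loc R) = length R + length (requests_of R)"
proof -
  have "snd (loop (\<lambda>(t, p) stps. do {
         charge (length p);
         ret (path_stops d s t (map loc p) @ stps) }) R acc) = length R + length (requests_of R)" for acc
    by (induction R arbitrary: acc) (auto simp: requests_of_def case_prod_unfold)
  then show ?thesis
    by (simp add: stops_def)
qed

section \<open>The dynamic program\<close>

text \<open>Comparison with a schedule asks only whether an entry is early enough, not which run it
  carries. In this form \<open>earlier\<close> becomes a disjunction, so updates preserve the
  property.\<close>

definition available :: "entry \<Rightarrow> real \<Rightarrow> bool" where
  "available e \<tau> \<longleftrightarrow> (\<exists>t R. e = Some (t, R) \<and> t \<le> \<tau>)"

lemma available_simps [simp]:
  "\<not> available None \<tau>"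
  "available (Some (t, R)) \<tau> \<longleftrightarrow> t \<le> \<tau>"
  by (auto simp: available_def)

lemma available_mono: "available e \<tau> \<Longrightarrow> \<tau> \<le> \<tau>' \<Longrightarrow> available e \<tau>'"
  by (auto simp: available_def)

lemma available_earlier: "available (earlier e e') \<tau> \<longleftrightarrow> available e \<tau> \<or> available e' \<tau>"
  by (induction e e' rule: earlier.induct) auto

lemma earlier_cases: "earlier e e' = e \<or> earlier e e' = e'"
  by (induction e e' rule: earlier.induct) auto

lemma available_append_path:
  assumes "available e \<tau>" "max T \<tau> + L / s < T + \<alpha>"
  shows "available (append_path s \<alpha> T L p e) (max T \<tau> + L / s)"
  using assms by (auto simp: available_def append_path_def Let_def max_def split: if_splits)

lemma available_update_mono:
  "available (D j P) \<tau> \<Longrightarrow> available (update D i Q e j P) \<tau>"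
  by (auto simp: update_def available_earlier)

lemma arrival_available:
  assumes "j \<in> set A" "available (D j P) \<tau>"
  shows "available (fst (arrival d s loc A D T i P)) (\<tau> + d (loc j) (loc i) / s)"
proof -
  obtain t R where "D j P = Some (t, R)" "t \<le> \<tau>"
    using assms(2) by (auto simp: available_def)
  then show ?thesis
    unfolding arrival_def fst_loop
    by (intro fold_reaches[OF assms(1), where Q = "\<lambda>e. available e (\<tau> + d (loc j) (loc i) / s)"])
      (auto simp: available_earlier)
qed

lemma arrival_available_start:
  "available (fst (arrival d s loc A D T i 0)) T"
  unfolding arrival_def fst_loop
  by (rule fold_preserves[where Q = "\<lambda>e. available e T"]) (auto simp: available_earlier)

lemma arrival_cases:
  assumes "fst (arrival d s loc A D T i P) = Some (t, R)"
  shows "P = 0 \<and> R = [] \<or>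
    (\<exists>j \<in> set A. \<exists>t0. D j P = Some (t0, R) \<and> t = t0 + d (loc j) (loc i) / s)"
proof -
  let ?Q = "\<lambda>e. \<forall>t R. e = Some (t, R) \<longrightarrow> P = 0 \<and> R = [] \<or>
    (\<exists>j \<in> set A. \<exists>t0. D j P = Some (t0, R) \<and> t = t0 + d (loc j) (loc i) / s)"
  have "?Q (fst (arrival d s loc A D T i P))"
    unfolding arrival_def fst_loop
  proof (rule fold_preserves[where Q = ?Q])
    fix j e
    assume "j \<in> set A" "?Q e"
    then show "?Q (fst (ret (earlier e (map_option (\<lambda>(t, R). (t + d (loc j) (loc i) / s, R)) (D j P)))))"
      using earlier_cases[of e "map_option (\<lambda>(t, R). (t + d (loc j) (loc i) / s, R)) (D j P)"]
      by fastforce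
  qed auto
  then show ?thesis
    using assms by blast
qed

text \<open>Profits are scanned upwards and every hit overwrites the previous one, so the last hit
  has the largest profit.\<close>

lemma best_partial_run:
  fixes D :: dp_table and A :: "nat list" and n :: nat
  defines "best \<equiv> fold (\<lambda>P. fold (\<lambda>j R. case D j P of None \<Rightarrow> R | Some (_, R') \<Rightarrow> R') A) [0..<Suc n] []"
  shows "best = [] \<or> (\<exists>j \<in> set A. \<exists>P t. D j P = Some (t, best))"
    and "j \<in> set A \<Longrightarrow> P \<le> n \<Longrightarrow> D j P = Some (t, R) \<Longrightarrow>
      \<exists>j \<in> set A. \<exists>P' t. P \<le> P' \<and> D j P' = Some (t, best)"
proof -
  show "best = [] \<or> (\<exists>j \<in> set A. \<exists>P t. D j P = Some (t, best))"
    unfolding best_def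
    by (intro fold_preserves[where Q = "\<lambda>R. R = [] \<or> (\<exists>j \<in> set A. \<exists>P t. D j P = Some (t, R))"])
      (auto split: option.splits)
next
  assume j: "j \<in> set A" "P \<le> n" "D j P = Some (t, R)"
  let ?Q = "\<lambda>R. \<exists>j \<in> set A. \<exists>P' t. P \<le> P' \<and> D j P' = Some (t, R)"
  let ?f = "\<lambda>P. fold (\<lambda>j R. case D j P of None \<Rightarrow> R | Some (_, R') \<Rightarrow> R') A"
  have "[0..<Suc n] = [0..<P] @ P # [Suc P..<Suc n]"
    using j(2) by (metis le_imp_less_Suc upt_add_eq_append upt_conv_Cons zero_le less_imp_le le_add_diff_inverse)
  then have "best = fold ?f [Suc P..<Suc n] (?f P (fold ?f [0..<P] []))"
    unfolding best_def by simp
  moreover have "?Q (fold ?f [Suc P..<Suc n] (?f P (fold ?f [0..<P] [])))"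
  proof (rule fold_preserves[where Q = ?Q])
    show "?Q (?f P (fold ?f [0..<P] []))"
      by (rule fold_reaches[OF j(1), where Q = ?Q]) (use j in \<open>auto split: option.splits\<close>)
  next
    fix P' R'
    assume "P' \<in> set [Suc P..<Suc n]" "?Q R'"
    then have "P \<le> P'"
      by (auto simp del: upt_Suc)
    then show "?Q (?f P' R')"
    proof (intro fold_preserves[where Q = ?Q] \<open>?Q R'\<close>)
      fix j' R''
      assume "j' \<in> set A" "?Q R''"
      then show "?Q (case D j' P' of None \<Rightarrow> R'' | Some (_, R') \<Rightarrow> R')"
        using \<open>P \<le> P'\<close> by (cases "D j' P'") (auto split: prod.splits)
    qed
  qed
  ultimately show "\<exists>j \<in> set A. \<exists>P' t. P \<le> P' \<and> D j P' = Some (t, best)"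
    by metis
qed

text \<open>No assumption mentions \<open>tr\<close> or \<open>\<delta>\<close>, so the locale
  predicate does not take them as arguments: one instance of it serves all offsets and
  trimmings.\<close>

locale period_program =
  fixes sub :: "'v subroutine" and V :: "'v set" and d :: "'v \<Rightarrow> 'v \<Rightarrow> real" and s :: real
    and n :: nat and loc :: "nat \<Rightarrow> 'v" and tr :: "nat \<Rightarrow> int option" and \<alpha> \<delta> \<gamma> :: real
    and \<Gamma> :: "nat \<Rightarrow> nat"
  assumes metric: "Metric_space V d"
    and speed: "s > 0"
    and period_length: "\<alpha> > 0"
    and locations: "loc ` {..<n} \<subseteq> V"
    and paths: "\<And>S. distinct S \<Longrightarrow> loc ` set S \<subseteq> V \<Longrightarrow>
      max_profit_paths \<gamma> d loc (set S) (fst (sub V d loc S)) \<and> snd (sub V d loc S) \<le> \<Gamma> (length S)"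
begin

sublocale Metric_space V d
  by (rule metric)

section \<open>Soundness: every table entry is a realizable run\<close>

abbreviation start :: "int \<Rightarrow> real" where
  "start k \<equiv> \<delta> + of_int k * \<alpha>"

text \<open>Distinctness makes \<open>P\<close> a count of different requests. Nonempty paths bound
  the number of paths by \<open>P\<close>, and the equality of nodes keeps the run inside
  \<open>V\<close> and makes it start at a request.\<close>

definition partial_run_ok :: "nat set \<Rightarrow> nat \<Rightarrow> nat \<Rightarrow> real \<Rightarrow> partial_run \<Rightarrow> bool" where
  "partial_run_ok A j P t R \<longleftrightarrow>
     R \<noteq> [] \<and> [] \<notin> snd ` set R \<and> distinct (requests_of R) \<and> set (requests_of R) \<subseteq> A \<and>
     length (requests_of R) = P \<and>
     last (run_of d s loc R) = (loc j, t) \<and> successively (run_step d s) (run_of d s loc R) \<and>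
     fst ` set (run_of d s loc R) = loc ` set (requests_of R) \<and>
     (\<forall>i \<in> set (requests_of R). \<exists>k t. tr i = Some k \<and> t \<in> period \<alpha> \<delta> k \<and>
        (loc i, t) \<in> set (run_of d s loc R))"

lemma partial_run_ok_run_nonempty: "partial_run_ok A j P t R \<Longrightarrow> run_of d s loc R \<noteq> []"
  by (cases R) (auto simp: partial_run_ok_def)

lemma partial_run_ok_mono: "partial_run_ok A j P t R \<Longrightarrow> A \<subseteq> B \<Longrightarrow> partial_run_ok B j P t R"
  by (auto simp: partial_run_ok_def)

lemma partial_run_ok_profit_le:
  assumes "partial_run_ok A j P t R" "A \<subseteq> {..<n}"
  shows "P \<le> n"
proof -
  have "P = card (set (requests_of R))"
    using assms(1) by (auto simp: partial_run_ok_def distinct_card)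
  also have "\<dots> \<le> card {..<n}"
    using assms by (intro card_mono) (auto simp: partial_run_ok_def)
  finally show ?thesis
    by simp
qed

text \<open>Waiting before \<open>b\<close> is implicit, since a step only requires enough elapsed
  time. Disjointness of \<open>A\<close> and \<open>S\<close> prevents double counting, and the
  strict bound keeps the last stop inside the half-open period.\<close>

lemma partial_run_ok_append:
  assumes R: "R = [] \<and> P = 0 \<or>
      (\<exists>j0 t0. partial_run_ok A j0 P t0 R \<and> t0 + d (loc j0) (loc i) / s \<le> b)"
    and p: "path_between S i j p" "\<And>i. i \<in> S \<Longrightarrow> tr i = Some k" "A \<inter> S = {}"
    and b: "start k \<le> b" "b + path_length d (map loc p) / s < start k + \<alpha>"
  shows "partial_run_ok (A \<union> S) j (P + length p) (b + path_length d (map loc p) / s) ((b, p) # R)"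
proof -
  let ?stops = "path_stops d s b (map loc p)"
  have p': "p \<noteq> []" "distinct p" "set p \<subseteq> S" "hd p = i" "last p = j"
    using p(1) by (auto simp: path_between_def)
  have ends: "hd ?stops = (loc i, b)" "last ?stops = (loc j, b + path_length d (map loc p) / s)"
    using p' by (auto simp: hd_path_stops last_path_stops hd_map last_map)
  have nodes: "fst ` set ?stops = loc ` set p"
    using fst_path_stops[of d s b "map loc p"] by (metis list.set_map)
  have mono: "successively (run_step d s) ?stops"
    using speed by (intro successively_path_stops) auto
  have visits: "\<exists>t. t \<in> period \<alpha> \<delta> k \<and> (loc i', t) \<in> set ?stops" if "i' \<in> set p" for i'
  proof -
    have "loc i' \<in> set (map loc p)"
      using that by simp
    from path_stops_times[where d = d, OF nonneg speed this, of b]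
    obtain t where "b \<le> t" "t \<le> b + path_length d (map loc p) / s" "(loc i', t) \<in> set ?stops"
      by blast
    then show ?thesis
      using b by (intro exI[of _ t]) (auto simp: period_def algebra_simps)
  qed
  have req: "requests_of ((b, p) # R) = p @ requests_of R"
    by (simp add: requests_of_def)
  show ?thesis
    using R
  proof (elim disjE conjE exE)
    assume "R = []" "P = 0"
    then show ?thesis
      using p' p(2) ends nodes mono visits
      unfolding partial_run_ok_def req by (auto simp: requests_of_def)
  next
    fix j0 t0
    assume ok: "partial_run_ok A j0 P t0 R" and t0: "t0 + d (loc j0) (loc i) / s \<le> b"
    have ne: "run_of d s loc R \<noteq> []"
      using ok by (rule partial_run_ok_run_nonempty)
    have "0 \<le> d (loc j0) (loc i) / s"
      using speed by simp
    moreover have "d (loc j0) (loc i) \<le> s * (b - t0)"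
      using t0 speed by (simp add: field_simps)
    ultimately have "run_step d s (last (run_of d s loc R)) (hd ?stops)"
      using ok t0 ends by (auto simp: partial_run_ok_def run_step_def)
    then have "successively (run_step d s) (run_of d s loc R @ ?stops)"
      using ok mono by (auto simp: successively_append_iff partial_run_ok_def)
    moreover have "distinct (p @ requests_of R)"
      using ok p' p(3) by (auto simp: partial_run_ok_def)
    moreover have "\<exists>k t. tr i' = Some k \<and> t \<in> period \<alpha> \<delta> k \<and> (loc i', t) \<in> set (run_of d s loc ((b, p) # R))"
      if "i' \<in> set (p @ requests_of R)" for i'
    proof (cases "i' \<in> set p")
      case True
      then show ?thesis
        using visits[OF True] p(2) p'(3) by auto
    next
      case False
      then have "i' \<in> set (requests_of R)"
        using that by simp
      then obtain k t where "tr i' = Some k" "t \<in> period \<alpha> \<delta> k" "(loc i', t) \<in> set (run_of d s loc R)"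
        using ok unfolding partial_run_ok_def by blast
      then show ?thesis
        by auto
    qed
    ultimately show ?thesis
      using ok p' ends nodes unfolding partial_run_ok_def req by (auto simp: image_Un)
  qed
qed

definition table_ok :: "nat set \<Rightarrow> dp_table \<Rightarrow> bool" where
  "table_ok A D \<longleftrightarrow> (\<forall>j P t R. D j P = Some (t, R) \<longrightarrow> partial_run_ok A j P t R)"

lemma table_ok_mono: "table_ok A D \<Longrightarrow> A \<subseteq> B \<Longrightarrow> table_ok B D"
  using partial_run_ok_mono unfolding table_ok_def by blast

lemma table_ok_update:
  assumes "table_ok A D" "\<And>t R. e = Some (t, R) \<Longrightarrow> partial_run_ok A j P t R"
  shows "table_ok A (update D j P e)"
  unfolding table_ok_def
proof (intro allI impI)
  fix j' P' t R
  assume *: "update D j P e j' P' = Some (t, R)"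
  show "partial_run_ok A j' P' t R"
  proof (cases "j' = j \<and> P' = P")
    case True
    then show ?thesis
      using * assms earlier_cases[of "D j P" e] by (auto simp: update_def table_ok_def)
  next
    case False
    then have "update D j P e j' P' = D j' P'"
      by (auto simp: update_def)
    then show ?thesis
      using * assms(1) by (auto simp: table_ok_def)
  qed
qed

text \<open>The guard mirrors the array of the program, which starts empty and is filled only for
  profits up to \<open>n\<close>.\<close>

definition arrivals :: "nat list \<Rightarrow> dp_table \<Rightarrow> real \<Rightarrow> nat \<Rightarrow> nat \<Rightarrow> entry" where
  "arrivals A D T i P = (if P \<le> n then fst (arrival d s loc A D T i P) else None)"

text \<open>\<open>arrivals\<close> reads the table \<open>D0\<close> from before the period while
  the updates go to the new one, so a run follows at most one path per period.\<close>

definition period_table :: "int \<Rightarrow> nat list \<Rightarrow> nat list \<Rightarrow> dp_table \<Rightarrow> dp_table" where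
  "period_table k S A D0 =
     fold (\<lambda>i. fold (\<lambda>j. fold (\<lambda>p. fold (\<lambda>P D.
       update D j (P + length p)
         (append_path s \<alpha> (start k) (path_length d (map loc p)) p (arrivals A D0 (start k) i P)))
       [0..<Suc n]) (fst (sub V d loc S) i j)) S) S D0"

lemma fst_process_period:
  "fst (process_period sub V d s loc n \<alpha> \<delta> (k, S) (A, D)) = (S @ A, period_table k S A D)"
proof -
  have "fold (\<lambda>P arr. arr(P := g P)) xs a = (\<lambda>P. if P \<in> set xs then g P else a P)"
    for g :: "nat \<Rightarrow> entry" and xs a
    by (induction xs arbitrary: a) auto
  then have "fold (\<lambda>P arr. arr(P := fst (arrival d s loc A D (start k) i P))) [0..<Suc n] (\<lambda>_. None) =
      arrivals A D (start k) i" for i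
    by (auto simp: arrivals_def fun_eq_iff less_Suc_eq_le simp del: upt_Suc)
  then show ?thesis
    by (simp add: process_period_def period_table_def Let_def del: upt_Suc)
qed

lemma period_table_mono:
  assumes "available (D j P) \<tau>"
  shows "available (period_table k S A D j P) \<tau>"
  unfolding period_table_def
  by (intro fold_preserves[where Q = "\<lambda>D. available (D j P) \<tau>"] available_update_mono assms)

lemma sub_paths:
  assumes "distinct S" "set S \<subseteq> {..<n}"
  shows "max_profit_paths \<gamma> d loc (set S) (fst (sub V d loc S))"
  using paths[OF assms(1)] assms(2) locations by blast

lemma period_table_ok:
  assumes D: "table_ok (set A) D" "\<forall>j P. j \<notin> set A \<longrightarrow> D j P = None"
    and S: "distinct S" "set S \<subseteq> {..<n}" "\<forall>i \<in> set S. tr i = Some k" "set A \<inter> set S = {}"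
  shows "table_ok (set A \<union> set S) (period_table k S A D)"
  unfolding period_table_def
proof (intro fold_preserves[where Q = "table_ok (set A \<union> set S)"])
  show "table_ok (set A \<union> set S) D"
    using D(1) by (rule table_ok_mono) auto
next
  fix i j p P D'
  assume i: "i \<in> set S" and j: "j \<in> set S" and p: "p \<in> set (fst (sub V d loc S) i j)"
    and D': "table_ok (set A \<union> set S) D'"
  have "path_between (set S) i j p"
    using sub_paths[OF S(1,2)] i j p by (auto simp: max_profit_paths_def)
  then show "table_ok (set A \<union> set S) (update D' j (P + length p)
       (append_path s \<alpha> (start k) (path_length d (map loc p)) p (arrivals A D (start k) i P)))"
  proof (intro table_ok_update D')
    fix t R
    assume path: "path_between (set S) i j p"
      and *: "append_path s \<alpha> (start k) (path_length d (map loc p)) p (arrivals A D (start k) i P) = Some (t, R)"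
    then obtain t0 R0 where e: "arrivals A D (start k) i P = Some (t0, R0)"
      by (auto simp: append_path_def split: option.splits)
    define b where "b = max (start k) t0"
    have t: "t = b + path_length d (map loc p) / s" "R = (b, p) # R0"
        "b + path_length d (map loc p) / s < start k + \<alpha>"
      using * by (auto simp: append_path_def e Let_def b_def split: if_splits)
    have "fst (arrival d s loc A D (start k) i P) = Some (t0, R0)"
      using e by (auto simp: arrivals_def split: if_splits)
    from arrival_cases[OF this]
    have "R0 = [] \<and> P = 0 \<or>
        (\<exists>j0 t1. partial_run_ok (set A) j0 P t1 R0 \<and> t1 + d (loc j0) (loc i) / s \<le> b)"
      using D(1) unfolding table_ok_def b_def by fastforce
    then show "partial_run_ok (set A \<union> set S) j (P + length p) t R"
      unfolding t(1,2) using S path t(3) b_def by (intro partial_run_ok_append) auto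
  qed
qed

lemma period_table_outside:
  assumes "\<forall>j P. j \<notin> set A \<longrightarrow> D j P = None"
  shows "\<forall>j P. j \<notin> set A \<union> set S \<longrightarrow> period_table k S A D j P = None"
  unfolding period_table_def
  by (intro fold_preserves[where Q = "\<lambda>D. \<forall>j P. j \<notin> set A \<union> set S \<longrightarrow> D j P = None"])
    (use assms in \<open>auto simp: update_def\<close>)

section \<open>Optimality: comparison of the table with an arbitrary schedule\<close>

lemma path_length_le_sorted:
  assumes "xs \<noteq> []" "sorted_wrt (\<lambda>i j. d (loc i) (loc j) \<le> s * (\<sigma> j - \<sigma> i)) xs"
  shows "path_length d (map loc xs) \<le> s * (\<sigma> (last xs) - \<sigma> (hd xs))"
  using assms
proof (induction xs rule: induct_list012)
  case (3 x y zs)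
  then have "path_length d (map loc (y # zs)) \<le> s * (\<sigma> (last (y # zs)) - \<sigma> y)"
    by auto
  moreover have "d (loc x) (loc y) \<le> s * (\<sigma> y - \<sigma> x)"
    using 3 by auto
  ultimately show ?case
    by (simp add: algebra_simps)
qed auto

text \<open>One witness \<open>j\<close> is enough: whoever is at \<open>j\<close> by time
  \<open>\<sigma> j\<close> can continue as the schedule does. Because the bound is linear in
  \<open>P\<close>, it survives adding the estimate for the next period.\<close>

definition reaches :: "nat set \<Rightarrow> (nat \<Rightarrow> real) \<Rightarrow> nat set \<Rightarrow> dp_table \<Rightarrow> bool" where
  "reaches G \<sigma> A D \<longleftrightarrow> G \<inter> A = {} \<or>
     (\<exists>j \<in> G \<inter> A. \<exists>P. available (D j P) (\<sigma> j) \<and> real (card (G \<inter> A)) \<le> \<gamma> * real P)"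

text \<open>Idea: replace the part of the schedule \<open>\<sigma>\<close> inside a period by a path of the
  subroutine with the same end points, which is no longer and loses only the factor \<open>\<gamma>\<close>.\<close>

lemma reaches_period:
  assumes D: "table_ok (set A) D"
    and A: "set A \<subseteq> {..<n}" "\<forall>i \<in> set A. \<exists>k'. tr i = Some k' \<and> k' < k"
    and S: "distinct S" "set S \<subseteq> {..<n}" "\<forall>i \<in> set S. tr i = Some k"
    and schedule: "\<And>i k. i \<in> G \<Longrightarrow> tr i = Some k \<Longrightarrow> \<sigma> i \<in> period \<alpha> \<delta> k"
      "\<And>i j. i \<in> G \<Longrightarrow> j \<in> G \<Longrightarrow> \<sigma> i \<le> \<sigma> j \<Longrightarrow> d (loc i) (loc j) \<le> s * (\<sigma> j - \<sigma> i)"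
    and reaches: "reaches G \<sigma> (set A) D"
  shows "reaches G \<sigma> (set A \<union> set S) (period_table k S A D)"
proof (cases "G \<inter> set S = {}")
  case True
  then have "G \<inter> (set A \<union> set S) = G \<inter> set A"
    by auto
  then show ?thesis
    using reaches unfolding reaches_def by (auto intro: period_table_mono)
next
  case False
  define xs where "xs = sort_key \<sigma> (filter (\<lambda>i. i \<in> G) S)"
  define i where "i = hd xs"
  define j where "j = last xs"
  have set_xs: "set xs = G \<inter> set S" and dist: "distinct xs"
    using S(1) by (auto simp: xs_def)
  then have ne: "xs \<noteq> []"
    using False by auto
  have ij: "i \<in> G" "i \<in> set S" "j \<in> G" "j \<in> set S"
    using set_xs ne unfolding i_def j_def using hd_in_set last_in_set by blast+
  have "sorted (map \<sigma> xs)"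
    by (simp add: xs_def)
  then have "sorted_wrt (\<lambda>i j. \<sigma> i \<le> \<sigma> j) xs"
    by (simp add: sorted_map)
  then have "sorted_wrt (\<lambda>i j. d (loc i) (loc j) \<le> s * (\<sigma> j - \<sigma> i)) xs"
    by (rule sorted_wrt_mono_rel[rotated]) (use schedule(2) set_xs in blast)
  then have "path_length d (map loc xs) \<le> s * (\<sigma> j - \<sigma> i)"
    unfolding i_def j_def using ne by (intro path_length_le_sorted)
  moreover have "path_between (set S) i j xs"
    using ne dist set_xs by (auto simp: path_between_def i_def j_def)
  ultimately obtain p where p: "p \<in> set (fst (sub V d loc S) i j)"
      "path_length d (map loc p) \<le> s * (\<sigma> j - \<sigma> i)" "real (length xs) \<le> \<gamma> * real (length p)"
    using sub_paths[OF S(1,2)] ij unfolding max_profit_paths_def by meson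
  have sigma: "start k \<le> \<sigma> i" "\<sigma> j < start k + \<alpha>"
    using schedule(1)[of i k] schedule(1)[of j k] ij S(3) by (auto simp: period_def algebra_simps)
  \<comment> \<open>\<open>P\<close> is the profit with which \<open>i\<close> can be entered by
    time \<open>\<sigma> i\<close>: 0 if the schedule starts in this period, otherwise the profit at
    the witness \<open>j0\<close>, which lies in a strictly earlier period and hence has
    \<open>\<sigma> j0 \<le> \<sigma> i\<close>.\<close>
  obtain P where P: "P \<le> n" "real (card (G \<inter> set A)) \<le> \<gamma> * real P"
      "available (arrivals A D (start k) i P) (\<sigma> i)"
  proof (cases "G \<inter> set A = {}")
    case True
    have "available (arrivals A D (start k) i 0) (\<sigma> i)"
      using available_mono[OF arrival_available_start sigma(1)] unfolding arrivals_def by simp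
    then show ?thesis
      using True that[of 0] by simp
  next
    case False
    then obtain j0 P where j0: "j0 \<in> G" "j0 \<in> set A" "available (D j0 P) (\<sigma> j0)"
        "real (card (G \<inter> set A)) \<le> \<gamma> * real P"
      using reaches unfolding reaches_def by auto
    obtain t R where "D j0 P = Some (t, R)"
      using j0(3) by (auto simp: available_def)
    then have Pn: "P \<le> n"
      using D A(1) partial_run_ok_profit_le unfolding table_ok_def by blast
    obtain k' where k': "tr j0 = Some k'" "k' < k"
      using A(2) j0 by auto
    have "\<sigma> j0 < \<delta> + (of_int k' + 1) * \<alpha>"
      using schedule(1)[OF j0(1) k'(1)] by (simp add: period_def)
    also have "\<dots> \<le> start k"
      using k'(2) period_length by (simp add: of_int_less_iff[symmetric] del: of_int_less_iff)
    also have "\<dots> \<le> \<sigma> i"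
      by (rule sigma)
    finally have "d (loc j0) (loc i) \<le> s * (\<sigma> i - \<sigma> j0)"
      using schedule(2) ij j0 by auto
    then have "\<sigma> j0 + d (loc j0) (loc i) / s \<le> \<sigma> i"
      using speed by (simp add: field_simps)
    then have "available (arrivals A D (start k) i P) (\<sigma> i)"
      using available_mono[OF arrival_available[where D = D and j = j0 and d = d and loc = loc,
            OF j0(2,3)]] Pn
      unfolding arrivals_def by simp
    then show ?thesis
      using that j0 Pn by blast
  qed
  let ?L = "path_length d (map loc p)"
  let ?Q = "\<lambda>D. available (D j (P + length p)) (\<sigma> j)"
  have "?L / s \<le> \<sigma> j - \<sigma> i"
    using p(2) speed by (simp add: field_simps)
  then have "available (append_path s \<alpha> (start k) ?L p (arrivals A D (start k) i P)) (\<sigma> j)"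
    using available_append_path[OF P(3), of "start k" ?L s \<alpha> p] sigma
    by (auto simp: max_def intro: available_mono)
  then have last_step: "available (update D' j (P + length p)
      (append_path s \<alpha> (start k) ?L p (arrivals A D (start k) i P)) j (P + length p)) (\<sigma> j)" for D'
    by (simp add: update_def available_earlier)
  have P_mem: "P \<in> set [0..<Suc n]"
    using P(1) by (auto simp del: upt_Suc)
  \<comment> \<open>The four loops meet \<open>i\<close>, \<open>j\<close>, \<open>p\<close> and
    \<open>P\<close>; that iteration makes the entry early enough in any table, and all others can
    only make it earlier.\<close>
  have "available (period_table k S A D j (P + length p)) (\<sigma> j)"
    unfolding period_table_def
    apply (rule fold_reaches[OF ij(2), where Q = ?Q])
     apply (rule fold_reaches[OF ij(4), where Q = ?Q])
      apply (rule fold_reaches[OF p(1), where Q = ?Q])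
       apply (rule fold_reaches[OF P_mem, where Q = ?Q])
        apply (rule last_step)
       apply (intro fold_preserves[where Q = ?Q] available_update_mono; assumption)+
    done
  moreover have "real (card (G \<inter> (set A \<union> set S))) \<le> \<gamma> * real (P + length p)"
  proof -
    have "card (G \<inter> (set A \<union> set S)) \<le> card (G \<inter> set A) + card (G \<inter> set S)"
      by (simp add: Int_Un_distrib card_Un_le)
    also have "card (G \<inter> set S) = length xs"
      using set_xs dist distinct_card by metis
    finally show ?thesis
      using p(3) P(2) by (simp add: algebra_simps)
  qed
  ultimately show ?thesis
    using ij unfolding reaches_def by blast
qed

text \<open>\<open>gs\<close> are the groups still to come. That all finished periods precede them
  makes the next group disjoint from \<open>A\<close> and allows travel from \<open>A\<close> into
  it.\<close>

definition program_state_ok :: "(int \<times> nat list) list \<Rightarrow> nat list \<times> dp_table \<Rightarrow> bool" where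
  "program_state_ok gs = (\<lambda>(A, D).
     table_ok (set A) D \<and> (\<forall>j P. j \<notin> set A \<longrightarrow> D j P = None) \<and> set A \<subseteq> {..<n} \<and>
     (\<forall>i \<in> set A. \<forall>k \<in> fst ` set gs. \<exists>k'. tr i = Some k' \<and> k' < k))"

lemma program_state_ok_step:
  assumes "program_state_ok ((k, S) # gs) (A, D)" "grouped tr B ((k, S) # gs)" "B \<subseteq> {..<n}"
  shows "program_state_ok gs (S @ A, period_table k S A D)"
proof -
  have A: "table_ok (set A) D" "\<forall>j P. j \<notin> set A \<longrightarrow> D j P = None" "set A \<subseteq> {..<n}"
      "\<And>i k'. i \<in> set A \<Longrightarrow> k' \<in> insert k (fst ` set gs) \<Longrightarrow> \<exists>l. tr i = Some l \<and> l < k'"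
    using assms(1) unfolding program_state_ok_def by auto
  have S: "distinct S" "set S \<subseteq> {..<n}" "\<forall>i \<in> set S. tr i = Some k" "\<forall>k' \<in> fst ` set gs. k < k'"
    using assms(2,3) unfolding grouped_Cons by auto
  have "set A \<inter> set S = {}"
    using A(4)[of _ k] S(3) by fastforce
  note tables = period_table_ok[OF A(1,2) S(1-3) this] period_table_outside[OF A(2), of S k]
  have "\<exists>l. tr i = Some l \<and> l < k'" if "i \<in> set (S @ A)" "k' \<in> fst ` set gs" for i k'
    using that A(4)[of i k'] S(3,4) by auto
  then show ?thesis
    using tables A(3) S(2) unfolding program_state_ok_def by (auto simp: Un_commute)
qed

lemma program_invariant:
  assumes "program_state_ok gs (A, D)" "grouped tr B gs" "B \<subseteq> {..<n}"
    and "fst (loop (process_period sub V d s loc n \<alpha> \<delta>) gs (A, D)) = (A', D')"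
  shows "program_state_ok [] (A', D') \<and> set A' = set A \<union> B"
  using assms
proof (induction gs arbitrary: A D B)
  case Nil
  then show ?case
    by (auto simp: grouped_def)
next
  case (Cons g gs)
  obtain k S where g: "g = (k, S)" by fastforce
  obtain B' where B': "grouped tr B' gs" "B = set S \<union> B'"
    using Cons.prems(2) unfolding g grouped_Cons by auto
  have "program_state_ok gs (S @ A, period_table k S A D)"
    using Cons.prems program_state_ok_step unfolding g by blast
  then show ?case
    using Cons.IH[of "S @ A" "period_table k S A D" B'] B' Cons.prems(3,4)
    by (auto simp: g fst_process_period)
qed

lemma program_reaches:
  assumes "program_state_ok gs (A, D)" "grouped tr B gs" "B \<subseteq> {..<n}"
    and schedule: "\<And>i k. i \<in> G \<Longrightarrow> tr i = Some k \<Longrightarrow> \<sigma> i \<in> period \<alpha> \<delta> k"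
      "\<And>i j. i \<in> G \<Longrightarrow> j \<in> G \<Longrightarrow> \<sigma> i \<le> \<sigma> j \<Longrightarrow> d (loc i) (loc j) \<le> s * (\<sigma> j - \<sigma> i)"
    and "reaches G \<sigma> (set A) D"
    and "fst (loop (process_period sub V d s loc n \<alpha> \<delta>) gs (A, D)) = (A', D')"
  shows "reaches G \<sigma> (set A') D'"
  using assms(1-3,6-)
proof (induction gs arbitrary: A D B)
  case (Cons g gs)
  obtain k S where g: "g = (k, S)" by fastforce
  obtain B' where B': "grouped tr B' gs" "B = set S \<union> B'" "distinct S" "\<forall>i \<in> set S. tr i = Some k"
    using Cons.prems(2) unfolding g grouped_Cons by auto
  have "program_state_ok gs (S @ A, period_table k S A D)"
    using Cons.prems program_state_ok_step unfolding g by blast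
  moreover have "reaches G \<sigma> (set (S @ A)) (period_table k S A D)"
    using reaches_period[of A D k S G \<sigma>] schedule B' Cons.prems
    unfolding g program_state_ok_def by (auto simp: Un_commute)
  ultimately show ?case
    using Cons.IH[of "S @ A" "period_table k S A D" B'] B' Cons.prems(3,5)
    by (auto simp: g fst_process_period)
qed auto

text \<open>Apply the guarantee of the subroutine to a single request: the only path available there
  has profit 1.\<close>

lemma factor_ge_1:
  assumes "n > 0"
  shows "1 \<le> \<gamma>"
proof -
  let ?paths = "fst (sub V d loc [0]) 0 0"
  have "max_profit_paths \<gamma> d loc {0} (fst (sub V d loc [0]))"
    using sub_paths[of "[0]"] assms by simp
  then have sound: "\<forall>p \<in> set ?paths. path_between {0} 0 0 p"
    and complete: "\<And>B p. path_between {0} 0 0 p \<Longrightarrow> path_length d (map loc p) \<le> B \<Longrightarrow>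
      \<exists>p' \<in> set ?paths. path_length d (map loc p') \<le> B \<and> real (length p) \<le> \<gamma> * real (length p')"
    by (simp_all add: max_profit_paths_def)
  have "path_between {0} 0 0 [0]"
    by (simp add: path_between_def)
  then obtain p where "p \<in> set ?paths" and p_len: "1 \<le> \<gamma> * real (length p)"
    using complete[of "[0]" "path_length d (map loc [0])"] by auto
  then have p: "path_between {0} 0 0 p"
    using sound by simp
  then have "length p = card (set p)" "set p = {0}"
    by (auto simp: path_between_def distinct_card subset_singleton_iff)
  then show ?thesis
    using p_len by simp
qed

section \<open>Number of steps of the dynamic program\<close>

lemma length_path_between: "path_between S i j p \<Longrightarrow> finite S \<Longrightarrow> length p \<le> card S"
  unfolding path_between_def by (metis card_mono distinct_card)

lemma snd_process_period:
  assumes "length A \<le> n" "S \<noteq> []" "distinct S" "set S \<subseteq> {..<n}"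
  shows "Suc (snd (process_period sub V d s loc n \<alpha> \<delta> (k, S) (A, D))) \<le>
    \<Gamma> (length S) + 13 * n ^ 3 * length S"
proof -
  have len_S: "length S \<le> n" "card (set S) = length S" "1 \<le> length S" "1 \<le> n"
  proof -
    show *: "length S \<le> n" "card (set S) = length S" "1 \<le> length S"
      using assms card_mono[of "{..<n}" "set S"] distinct_card[OF assms(3)] by (auto simp: Suc_le_eq)
    show "1 \<le> n"
      using *(1,3) by simp
  qed
  have sub: "max_profit_paths \<gamma> d loc (set S) (fst (sub V d loc S))" "snd (sub V d loc S) \<le> \<Gamma> (length S)"
    using paths[OF assms(3)] assms(4) locations by blast+
  have num_paths: "length (fst (sub V d loc S) i j) \<le> n" if "i \<in> set S" "j \<in> set S" for i j
    using sub(1) that len_S unfolding max_profit_paths_def by fastforce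
  have len_path: "length p \<le> n" if "i \<in> set S" "j \<in> set S" "p \<in> set (fst (sub V d loc S) i j)" for i j p
    using sub(1) that len_S length_path_between[of "set S" i j p] unfolding max_profit_paths_def by fastforce
  have arrival: "snd (arrival d s loc A D T i P) \<le> n * (1 + 0)" for T i P
    unfolding arrival_def by (rule order_trans[OF snd_loop_le[where b = 0]]) (use assms in auto)
  have arr: "snd (loop (\<lambda>P arr. bind_timed (arrival d s loc A D T i P) (\<lambda>e. ret (arr(P := e))))
      [0..<Suc n] (\<lambda>_. None)) \<le> Suc n * (1 + n)" for T i
    by (rule order_trans[OF snd_loop_le[where b = n]]) (use arrival in \<open>auto simp del: upt_Suc\<close>)
  have upd: "snd (loop (\<lambda>P D4. ret (f P D4)) [0..<Suc n] D3) \<le> Suc n"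
    for f :: "nat \<Rightarrow> dp_table \<Rightarrow> dp_table" and D3
    by (rule order_trans[OF snd_loop_le[where b = 0]]) (auto simp del: upt_Suc)
  \<comment> \<open>\<open>b1\<close> bounds the work on one path, \<open>b2\<close> on all paths
    between two given ends, and \<open>b3\<close> on one first request \<open>i\<close>, including
    its arrivals.\<close>
  define b1 where "b1 = n + Suc n"
  define b2 where "b2 = n * (1 + b1)"
  define b3 where "b3 = Suc n * (1 + n) + n * (1 + b2)"
  have "snd (process_period sub V d s loc n \<alpha> \<delta> (k, S) (A, D)) \<le>
      \<Gamma> (length S) + length S * (1 + b3) + length S"
    unfolding process_period_def Let_def prod.case snd_bind snd_charge snd_ret add_0_right add.assoc[symmetric]
  proof (intro add_mono sub(2) order_refl snd_loop_le)
    fix i D1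
    assume i: "i \<in> set S"
    have "snd (loop (\<lambda>j D2.
             loop (\<lambda>p D3. do {
                 charge (length p);
                 loop (\<lambda>P D4. ret (update D4 j (P + length p) (append_path s \<alpha> (start k)
                    (path_length d (map loc p)) p (arr P))))
                   [0..<Suc n] D3 }) (fst (sub V d loc S) i j) D2) S D1) \<le> n * (1 + b2)" for arr
    proof (rule order_trans[OF snd_loop_le[where b = b2]])
      fix j D2
      assume j: "j \<in> set S"
      show "snd (loop (\<lambda>p D3. do {
                 charge (length p);
                 loop (\<lambda>P D4. ret (update D4 j (P + length p) (append_path s \<alpha> (start k)
                    (path_length d (map loc p)) p (arr P))))
                   [0..<Suc n] D3 }) (fst (sub V d loc S) i j) D2) \<le> b2"
        unfolding b2_def
      proof (rule order_trans[OF snd_loop_le[where b = b1]])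
        fix p D3
        assume "p \<in> set (fst (sub V d loc S) i j)"
        then show "snd (do {
                 charge (length p);
                 loop (\<lambda>P D4. ret (update D4 j (P + length p) (append_path s \<alpha> (start k)
                    (path_length d (map loc p)) p (arr P))))
                   [0..<Suc n] D3 }) \<le> b1"
          unfolding snd_bind snd_charge b1_def by (intro add_mono len_path[OF i j] upd)
      qed (intro mult_le_mono1 num_paths i j)
    qed (intro mult_le_mono1 len_S)
    then show "snd (do {
           arr \<leftarrow> loop (\<lambda>P arr. do {
               e \<leftarrow> arrival d s loc A D (start k) i P;
               ret (arr(P := e)) }) [0..<Suc n] (\<lambda>_. None);
           loop (\<lambda>j D2.
             loop (\<lambda>p D3. do {
                 charge (length p);
                 loop (\<lambda>P D4. ret (update D4 j (P + length p) (append_path s \<alpha> (start k)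
                    (path_length d (map loc p)) p (arr P))))
                   [0..<Suc n] D3 }) (fst (sub V d loc S) i j) D2) S D1 }) \<le> b3"
      unfolding snd_bind b3_def by (intro add_mono arr)
  qed
  \<comment> \<open>Of the 3, one unit is the loop iteration, one the charge for joining the lists,
    and one pays for the outer \<open>Suc\<close>, as \<open>S\<close> is nonempty. The coefficients
    of the polynomial below sum to 12.\<close>
  moreover have "3 + b3 \<le> 13 * n ^ 3"
  proof -
    have "3 + b3 = 4 + 3 * n + 3 * n ^ 2 + 2 * n ^ 3"
      by (simp add: b3_def b2_def b1_def algebra_simps power2_eq_square power3_eq_cube)
    moreover have "1 \<le> n ^ 3" "n \<le> n ^ 3" "n ^ 2 \<le> n ^ 3"
      using len_S(4) power_increasing[of 1 3 n] power_increasing[of 2 3 n] by auto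
    ultimately show ?thesis
      by linarith
  qed
  then have "length S * (3 + b3) \<le> 13 * n ^ 3 * length S"
    by (metis mult.commute mult_le_mono1)
  ultimately show ?thesis
    using len_S(3) by (simp add: algebra_simps)
qed

lemma snd_program:
  assumes "grouped tr B gs" "B \<subseteq> {..<n}" "length A + (\<Sum>(k, S)\<leftarrow>gs. length S) \<le> n"
  shows "snd (loop (process_period sub V d s loc n \<alpha> \<delta>) gs (A, D)) \<le>
      (\<Sum>(k, S)\<leftarrow>gs. \<Gamma> (length S) + 13 * n ^ 3 * length S) \<and>
    length (fst (fst (loop (process_period sub V d s loc n \<alpha> \<delta>) gs (A, D)))) \<le> n"
  using assms
proof (induction gs arbitrary: A D B)
  case (Cons g gs)
  obtain k S where g: "g = (k, S)" by fastforce
  obtain B' where B': "grouped tr B' gs" "B = set S \<union> B'" "distinct S" "S \<noteq> []"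
    using Cons.prems(1) unfolding g grouped_Cons by auto
  have "Suc (snd (process_period sub V d s loc n \<alpha> \<delta> (k, S) (A, D))) \<le>
    \<Gamma> (length S) + 13 * n ^ 3 * length S"
    using B' Cons.prems g by (intro snd_process_period) auto
  moreover have "length (S @ A) + (\<Sum>(k, S)\<leftarrow>gs. length S) \<le> n" "B' \<subseteq> {..<n}"
    using B' Cons.prems g by auto
  note Cons.IH[OF B'(1) this(2,1), of "period_table k S A D"]
  ultimately show ?case
    by (simp add: g fst_process_period)
qed simp

end

text \<open>Superadditivity of \<open>\<Gamma>\<close> is what merges the calls of the subroutine in
  the different periods into one \<open>\<Gamma>\<close> of the total size.\<close>

lemma sum_list_time_bound:
  assumes "running_time_bound \<Gamma>"
  shows "(\<Sum>x\<leftarrow>xs. \<Gamma> (f x) + a * f x) \<le> \<Gamma> (\<Sum>x\<leftarrow>xs. f x) + a * (\<Sum>x\<leftarrow>xs. f x)"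
proof (induction xs)
  case (Cons x xs)
  have "\<Gamma> (f x) + \<Gamma> (\<Sum>x\<leftarrow>xs. f x) \<le> \<Gamma> (f x + (\<Sum>x\<leftarrow>xs. f x))"
    using assms by (simp add: running_time_bound_def)
  then show ?case
    using Cons by (simp add: algebra_simps)
qed simp

lemma time_bound_mono:
  assumes "running_time_bound \<Gamma>" "a \<le> b"
  shows "\<Gamma> a \<le> \<Gamma> b"
proof -
  have "\<Gamma> a + \<Gamma> (b - a) \<le> \<Gamma> (a + (b - a))"
    using assms(1) unfolding running_time_bound_def by blast
  then show ?thesis
    using assms(2) by simp
qed

text \<open>In \<open>speedup_profit\<close>, a set \<open>G\<close> of requests with visiting times \<open>\<sigma>\<close> stands for an arbitrary run at
  speed \<open>s\<close> that visits these requests in the periods they are trimmed to.\<close>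

lemma
  fixes reqs :: "'v request list" and sub :: "'v subroutine" and V :: "'v set"
    and d :: "'v \<Rightarrow> 'v \<Rightarrow> real" and \<alpha> \<delta> s \<gamma> :: real and c :: "nat list"
  defines "n \<equiv> length reqs" and "loc \<equiv> \<lambda>i. node (reqs ! i)"
    and "tr \<equiv> \<lambda>i. trimmed_period \<alpha> \<delta> c (reqs ! i)"
    and "R \<equiv> speedup sub V d s reqs \<alpha> \<delta> c"
  assumes program: "period_program sub V d s n loc \<alpha> \<gamma> \<Gamma>"
  shows speedup_service_run: "fst R = [] \<or> service_run V d reqs s (fst R)"
    and speedup_length: "length (fst R) \<le> n"
    and speedup_time: "running_time_bound \<Gamma> \<Longrightarrow> n > 0 \<Longrightarrow> snd R \<le> 23 * \<Gamma> n"
    and speedup_profit: "G \<noteq> {} \<Longrightarrow> G \<subseteq> {..<n} \<Longrightarrow>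
      (\<And>i. i \<in> G \<Longrightarrow> \<exists>k. tr i = Some k \<and> \<sigma> i \<in> period \<alpha> \<delta> k) \<Longrightarrow>
      (\<And>i j. i \<in> G \<Longrightarrow> j \<in> G \<Longrightarrow> \<sigma> i \<le> \<sigma> j \<Longrightarrow> d (loc i) (loc j) \<le> s * (\<sigma> j - \<sigma> i)) \<Longrightarrow>
      (\<And>i k. i < n \<Longrightarrow> tr i = Some k \<Longrightarrow> period \<alpha> \<delta> k \<subseteq> window (reqs ! i)) \<Longrightarrow>
      real (card G) \<le> \<gamma> * real (profit reqs (fst R))"
proof -
  interpret period_program sub V d s n loc tr \<alpha> \<delta> \<gamma> \<Gamma>
    by (rule program)
  define gs where "gs = fst (group_requests \<alpha> \<delta> c reqs)"
  define B where "B = {i. i < n \<and> tr i \<noteq> None}"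
  have gs: "grouped tr B gs"
    using grouped_group_requests(1)[of \<alpha> \<delta> c reqs] by (simp add: gs_def B_def tr_def n_def)
  have B: "B \<subseteq> {..<n}" "finite B"
    by (auto simp: B_def)
  obtain A D where AD: "fst (loop (process_period sub V d s loc n \<alpha> \<delta>) gs ([], \<lambda>_ _. None)) = (A, D)"
    by fastforce
  define best where
    "best = fold (\<lambda>P. fold (\<lambda>j R. case D j P of None \<Rightarrow> R | Some (_, R') \<Rightarrow> R') A) [0..<Suc n] []"
  have loop_best: "fst (loop (\<lambda>P. loop (\<lambda>j R. ret (case D j P of None \<Rightarrow> R | Some (_, R') \<Rightarrow> R')) A)
      [0..<Suc n] []) = best"
    by (simp add: best_def del: upt_Suc)
  have fst_R: "fst R = run_of d s loc best"
    unfolding R_def speedup_def Let_def n_def[symmetric] loc_def[symmetric] fst_bind gs_def[symmetric]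
      AD prod.case loop_best run_of_def ..
  have snd_R: "snd R = snd (group_requests \<alpha> \<delta> c reqs) +
      (snd (loop (process_period sub V d s loc n \<alpha> \<delta>) gs ([], \<lambda>_ _. None)) +
      (snd (loop (\<lambda>P. loop (\<lambda>j R. ret (case D j P of None \<Rightarrow> R | Some (_, R') \<Rightarrow> R')) A) [0..<Suc n] []) +
       snd (stops d s loc best)))"
    unfolding R_def speedup_def Let_def n_def[symmetric] loc_def[symmetric] snd_bind fst_bind gs_def[symmetric]
      AD prod.case loop_best ..
  have init: "program_state_ok gs ([], \<lambda>_ _. None)"
    by (auto simp: program_state_ok_def table_ok_def)
  have "program_state_ok [] (A, D)" and set_A: "set A = B"
    using program_invariant[OF init gs B(1) AD] by auto
  then have table: "table_ok B D"
    by (auto simp: program_state_ok_def)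
  have best_ok: "best = [] \<or> (\<exists>j P t. partial_run_ok B j P t best)"
    using best_partial_run(1)[where A = A and D = D and n = n] table unfolding best_def[symmetric] table_ok_def
    by blast
  have req_len: "length (requests_of best) \<le> n" "length best \<le> n"
  proof -
    show *: "length (requests_of best) \<le> n"
      using best_ok partial_run_ok_profit_le[OF _ B(1)]
      by (auto simp: partial_run_ok_def requests_of_def)
    have "[] \<notin> snd ` set R \<Longrightarrow> length R \<le> length (requests_of R)" for R
      by (induction R) (auto simp: requests_of_def Suc_le_eq intro: add_le_mono[of 1, simplified])
    then have "length best \<le> length (requests_of best)"
      using best_ok by (auto simp: partial_run_ok_def)
    then show "length best \<le> n"
      using * by simp
  qed
  show "length (fst R) \<le> n"
    using req_len(1) by (simp add: fst_R length_run_of)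
  show "fst R = [] \<or> service_run V d reqs s (fst R)"
    using best_ok
  proof (elim disjE exE)
    fix j P t
    assume ok: "partial_run_ok B j P t best"
    have nodes: "fst ` set (fst R) = loc ` set (requests_of best)" "set (requests_of best) \<subseteq> {..<n}"
      using ok B(1) by (auto simp: fst_R partial_run_ok_def)
    have ne: "fst R \<noteq> []"
      using partial_run_ok_run_nonempty[OF ok] by (simp add: fst_R)
    then have "fst (hd (fst R)) \<in> loc ` {..<n}"
      using nodes by (metis hd_in_set imageI image_mono subsetD)
    moreover have "loc ` {..<n} \<subseteq> node ` set reqs"
      by (auto simp: loc_def n_def)
    moreover have "fst ` set (fst R) \<subseteq> V"
      using nodes locations by auto
    ultimately show ?thesis
      using ok ne unfolding service_run_def fst_R partial_run_ok_def run_step_def by auto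
  qed (simp add: fst_R)
  show "snd R \<le> 23 * \<Gamma> n" if \<Gamma>: "running_time_bound \<Gamma>" "n > 0"
  proof -
    have sizes: "(\<Sum>(k, S)\<leftarrow>gs. length S) \<le> n"
      using length_groups_le[OF gs B(2)] card_mono[OF _ B(1)] by simp
    have t1: "snd (group_requests \<alpha> \<delta> c reqs) \<le> n * (2 + n)"
      using grouped_group_requests(2) by (simp add: n_def)
    note program_time = snd_program[OF gs B(1), of "[]" "\<lambda>_ _. None"]
    have len_A: "length A \<le> n"
      using program_time sizes unfolding AD by auto
    have "snd (loop (process_period sub V d s loc n \<alpha> \<delta>) gs ([], \<lambda>_ _. None)) \<le>
        (\<Sum>(k, S)\<leftarrow>gs. \<Gamma> (length S) + 13 * n ^ 3 * length S)"
      using program_time sizes by auto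
    also have "(\<Sum>(k, S)\<leftarrow>gs. \<Gamma> (length S) + 13 * n ^ 3 * length S) \<le>
        \<Gamma> (\<Sum>(k, S)\<leftarrow>gs. length S) + 13 * n ^ 3 * (\<Sum>(k, S)\<leftarrow>gs. length S)"
      using sum_list_time_bound[OF \<Gamma>(1), where f = "\<lambda>(k, S). length S" and xs = gs and a = "13 * n ^ 3"]
      by (simp add: case_prod_unfold)
    also have "\<dots> \<le> \<Gamma> n + 13 * n ^ 3 * n"
      using sizes by (intro add_mono time_bound_mono[OF \<Gamma>(1)]) auto
    also have "13 * n ^ 3 * n = 13 * n ^ 4"
      by (simp add: power3_eq_cube power4_eq_xxxx)
    finally have t2: "snd (loop (process_period sub V d s loc n \<alpha> \<delta>) gs ([], \<lambda>_ _. None)) \<le>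
      \<Gamma> n + 13 * n ^ 4" .
    have t3: "snd (loop (\<lambda>P. loop (\<lambda>j R. ret (case D j P of None \<Rightarrow> R | Some (_, R') \<Rightarrow> R')) A) [0..<Suc n] [])
        \<le> Suc n * (1 + n)"
    proof (rule order_trans[OF snd_loop_le[where b = n]])
      fix P R
      show "snd (loop (\<lambda>j R. ret (case D j P of None \<Rightarrow> R | Some (_, R') \<Rightarrow> R')) A R) \<le> n"
        by (rule order_trans[OF snd_loop_le[where b = 0]]) (use len_A in auto)
    qed (simp del: upt_Suc)
    have t4: "snd (stops d s loc best) \<le> n + n"
      unfolding snd_stops using req_len by (intro add_mono)
    have "1 \<le> n ^ 4" "n \<le> n ^ 4" "n ^ 2 \<le> n ^ 4" "n ^ 4 \<le> \<Gamma> n"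
      using \<Gamma> power_increasing[of 1 4 n] power_increasing[of 2 4 n]
      by (auto simp: running_time_bound_def)
    \<comment> \<open>All powers are at most \<open>n ^ 4 \<le> \<Gamma> n\<close>, so the constant
      is \<open>1 + 13 + 2 + 6 + 1 = 23\<close>.\<close>
    moreover have "n * (2 + n) + (\<Gamma> n + 13 * n ^ 4 + (Suc n * (1 + n) + (n + n))) =
        \<Gamma> n + 13 * n ^ 4 + 2 * n ^ 2 + 6 * n + 1"
      by (simp add: algebra_simps power2_eq_square)
    moreover have "snd R \<le> n * (2 + n) + (\<Gamma> n + 13 * n ^ 4 + (Suc n * (1 + n) + (n + n)))"
      unfolding snd_R by (intro add_mono t1 t2 t3 t4)
    ultimately show ?thesis
      by linarith
  qed
  assume G: "G \<noteq> {}" "G \<subseteq> {..<n}" "\<And>i. i \<in> G \<Longrightarrow> \<exists>k. tr i = Some k \<and> \<sigma> i \<in> period \<alpha> \<delta> k"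
    and steps: "\<And>i j. i \<in> G \<Longrightarrow> j \<in> G \<Longrightarrow> \<sigma> i \<le> \<sigma> j \<Longrightarrow> d (loc i) (loc j) \<le> s * (\<sigma> j - \<sigma> i)"
    and trimmed: "\<And>i k. i < n \<Longrightarrow> tr i = Some k \<Longrightarrow> period \<alpha> \<delta> k \<subseteq> window (reqs ! i)"
  have "reaches G \<sigma> (set A) D"
  proof (rule program_reaches[OF init gs B(1) _ steps _ AD])
    show "\<sigma> i \<in> period \<alpha> \<delta> k" if "i \<in> G" "tr i = Some k" for i k
      using G(3) that by fastforce
    show "reaches G \<sigma> (set []) (\<lambda>_ _. None)"
      by (simp add: reaches_def)
  qed auto
  moreover have "G \<inter> set A = G"
    using G by (fastforce simp: set_A B_def)
  ultimately obtain j P where j: "j \<in> set A" "available (D j P) (\<sigma> j)" "real (card G) \<le> \<gamma> * real P"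
    using G(1) unfolding reaches_def by auto
  then obtain t R' where D: "D j P = Some (t, R')"
    by (auto simp: available_def)
  then have "P \<le> n"
    using partial_run_ok_profit_le[OF _ B(1)] table unfolding table_ok_def by blast
  from best_partial_run(2)[where n = n and D = D and j = j, OF j(1) this D]
  obtain j' P' t' where P': "P \<le> P'" "D j' P' = Some (t', best)"
    unfolding best_def[symmetric] by auto
  then have ok: "partial_run_ok B j' P' t' best"
    using table unfolding table_ok_def by blast
  have "set (requests_of best) \<subseteq> {i. i < length reqs \<and> served (fst R) (reqs ! i)}"
  proof
    fix i
    assume i: "i \<in> set (requests_of best)"
    then have "i < n"
      using ok B(1) by (auto simp: partial_run_ok_def)
    moreover obtain k t where "tr i = Some k" "t \<in> period \<alpha> \<delta> k" "(loc i, t) \<in> set (fst R)"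
      using ok i unfolding partial_run_ok_def fst_R by blast
    ultimately have "t \<in> window (reqs ! i)" "(node (reqs ! i), t) \<in> set (fst R)"
      using trimmed by (auto simp: loc_def)
    then show "i \<in> {i. i < length reqs \<and> served (fst R) (reqs ! i)}"
      using \<open>i < n\<close> by (auto simp: n_def served_def)
  qed
  then have "card (set (requests_of best)) \<le> profit reqs (fst R)"
    unfolding profit_def length_filter_conv_card by (intro card_mono) auto
  moreover have "card (set (requests_of best)) = P'"
    using ok by (auto simp: partial_run_ok_def distinct_card)
  ultimately have "P \<le> profit reqs (fst R)"
    using P' by simp
  moreover have "0 \<le> \<gamma>"
    using factor_ge_1 G by (cases "n = 0") auto
  ultimately show "real (card G) \<le> \<gamma> * real (profit reqs (fst R))"
    using j(3) by (meson mult_left_mono of_nat_le_iff order_trans)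
qed
section \<open>The reference schedule\<close>

text \<open>By the triangle inequality the step relation is transitive on the stops, so it holds
  between any two of them in list order; symmetry of \<open>d\<close> covers the reverse
  order.\<close>

lemma service_run_dist:
  assumes "Metric_space V d" "service_run V d reqs s R" "(u, t) \<in> set R" "(v, t') \<in> set R"
  shows "d u v \<le> s * \<bar>t' - t\<bar>"
proof -
  interpret Metric_space V d
    by (rule assms)
  let ?P = "\<lambda>(u, t) (v, t'). t \<le> t' \<and> d u v \<le> s * (t' - t)"
  have V: "fst ` set R \<subseteq> V" and step: "successively ?P R"
    using assms(2) by (auto simp: service_run_def)
  have sorted: "sorted_wrt ?P R"
  proof (rule iffD1[OF successively_iff_sorted_wrt_strong step])
    fix x y z
    assume xyz: "x \<in> set R" "y \<in> set R" "z \<in> set R" "?P x y" "?P y z"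
    then have "d (fst x) (fst z) \<le> d (fst x) (fst y) + d (fst y) (fst z)"
      using V by (intro triangle) auto
    then show "?P x z"
      using xyz by (auto simp: algebra_simps)
  qed
  have self: "d u u = 0" if "u \<in> V" for u
    using that by simp
  obtain i j where ij: "i < length R" "j < length R" "R ! i = (u, t)" "R ! j = (v, t')"
    using assms(3,4) by (metis in_set_conv_nth)
  consider "i < j" | "i = j" | "j < i"
    by linarith
  then show ?thesis
  proof cases
    case 1
    then show ?thesis
      using sorted_wrt_nth_less[OF sorted 1] ij by auto
  next
    case 2
    then show ?thesis
      using ij V assms(3) self by auto
  next
    case 3
    then show ?thesis
      using sorted_wrt_nth_less[OF sorted 3] ij commute[of u v] by auto
  qed
qed

text \<open>One of \<open>a\<close> and \<open>a + 1\<close> is even, so two neighbours among the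
  three half periods form a unit period. The first unit period \<open>k\<close> has
  \<open>2 * k\<close> equal to that even number, by integrality. On each side the window exceeds
  the three half periods by less than 1/2, which gives the enclosing interval in both cases.\<close>

lemma three_full_periods_unit_grid:
  assumes "three_full_periods (1/2) \<delta> x" "T = \<delta> + of_int (first_full_period 1 \<delta> x)"
  shows "num_full_periods 1 \<delta> x > 0" "window x \<subseteq> {T - 1 ..< T + 2}"
proof -
  let ?w = "win_start x" and ?e = "win_start x + win_len x"
  obtain a where a: "{i. period (1/2) \<delta> i \<subseteq> window x} = {a, a + 1, a + 2}"
    using assms(1) unfolding three_full_periods_def by blast
  have sub: "period (1/2) \<delta> i \<subseteq> window x \<longleftrightarrow> ?w \<le> \<delta> + of_int i / 2 \<and> \<delta> + (of_int i + 1) / 2 \<le> ?e" for i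
    by (simp add: period_def window_def atLeastLessThan_subset_iff field_simps)
  have "period (1/2) \<delta> a \<subseteq> window x" "period (1/2) \<delta> (a + 2) \<subseteq> window x"
    "\<not> period (1/2) \<delta> (a - 1) \<subseteq> window x" "\<not> period (1/2) \<delta> (a + 3) \<subseteq> window x"
  proof -
    have "period (1/2) \<delta> i \<subseteq> window x \<longleftrightarrow> i \<in> {a, a + 1, a + 2}" for i
      using a by blast
    then show "period (1/2) \<delta> a \<subseteq> window x" "period (1/2) \<delta> (a + 2) \<subseteq> window x"
      "\<not> period (1/2) \<delta> (a - 1) \<subseteq> window x" "\<not> period (1/2) \<delta> (a + 3) \<subseteq> window x"
      by simp_all
  qed
  then have w: "?w \<le> \<delta> + of_int a / 2" "\<delta> + (of_int a + 3) / 2 \<le> ?e"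
      "\<delta> + (of_int a - 1) / 2 < ?w" "?e < \<delta> + (of_int a + 4) / 2"
    unfolding sub by (auto simp: field_simps)
  define k where "k = first_full_period 1 \<delta> x"
  have k: "?w - \<delta> \<le> of_int k" "of_int k < ?w - \<delta> + 1"
    unfolding k_def first_full_period_def by (simp_all add: le_of_int_ceiling) linarith
  have "of_int (a - 1) < (of_int (2 * k) :: real)" "of_int (2 * k) < (of_int (a + 2) :: real)"
    using k w by (auto simp: field_simps)
  then have "a \<le> 2 * k" "2 * k \<le> a + 1"
    by linarith+
  then have k': "of_int a \<le> 2 * (of_int k :: real)" "2 * of_int k \<le> (of_int a + 1 :: real)"
    by linarith+
  have "k + 1 \<le> \<lfloor>(?e - \<delta>) / 1\<rfloor>"
    using k' w by (simp add: le_floor_iff field_simps)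
  then show "num_full_periods 1 \<delta> x > 0"
    by (simp add: num_full_periods_def k_def)
  show "window x \<subseteq> {T - 1 ..< T + 2}"
    using k k' w unfolding assms(2) k_def[symmetric] by (auto simp: window_def field_simps)
qed

text \<open>The default 0 in \<open>trimmed_period\<close> for windows with more than four periods
  agrees with this choice, so no bound on their number is required.\<close>

lemma trimmed_to_first_period:
  "trimmed_period \<alpha> \<delta> [0, 0, 0, 0] x =
    (if num_full_periods \<alpha> \<delta> x = 0 then None else Some (first_full_period \<alpha> \<delta> x))"
proof -
  have "[0, 0, 0, 0] ! (k - 1) = (0 :: nat)" if "k \<le> 4" for k
    using that by (auto simp: nth_Cons split: nat.split)
  then show ?thesis
    by (simp add: trimmed_period_def Let_def)
qed

text \<open>During a period that starts at time \<open>T\<close>, the run at speed \<open>2\<close> below follows the reference run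
  through its time interval from \<open>T + o\<close> to \<open>T + o + 3/2\<close>, which takes \<open>3/4\<close> of the period; the rest
  of the period suffices to go back by \<open>1/2\<close> to the beginning of the next interval.\<close>

lemma sawtooth_speed:
  fixes v v' o' :: real and k k' :: int
  defines "\<sigma> \<equiv> \<lambda>k v. of_int k + (v - of_int k - o') / 2"
  assumes "of_int k + o' \<le> v" "v < of_int k + o' + 3/2"
    and "of_int k' + o' \<le> v'" "v' < of_int k' + o' + 3/2"
    and "\<sigma> k v \<le> \<sigma> k' v'"
  shows "\<bar>v' - v\<bar> \<le> 2 * (\<sigma> k' v' - \<sigma> k v)"
proof -
  \<comment> \<open>\<open>\<sigma> k v\<close> lies between \<open>k\<close> and
    \<open>k + 3/4\<close>, so the order of sawtooth times respects the order of periods.\<close>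
  have "k \<le> k'"
  proof (rule ccontr)
    assume "\<not> k \<le> k'"
    then have "of_int k' + 1 \<le> (of_int k :: real)"
      by linarith
    then show False
      using assms(2-) unfolding \<sigma>_def by (simp add: field_simps)
  qed
  \<comment> \<open>Twice the sawtooth gap is \<open>v' - v + k' - k\<close>. Going backward
    therefore needs \<open>2 * (v - v') \<le> k' - k\<close>, which follows from
    \<open>v - v' < 3/2 - (k' - k)\<close> and is tight for neighbouring periods.\<close>
  then consider "k = k'" | "of_int k + 1 \<le> (of_int k' :: real)"
    by linarith
  then show ?thesis
    using assms(2-) unfolding \<sigma>_def abs_le_iff by cases (auto simp: field_simps)
qed

text \<open>The two values of \<open>o'\<close> are \<open>-1\<close> and \<open>1/2\<close>: since a window lies in \<open>[T - 1, T + 2)\<close>, each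
  visit of the reference run is repeated by at least one of the two sawtooth runs.\<close>

lemma speedup_half:
  fixes reqs :: "'v request list" and V :: "'v set" and d :: "'v \<Rightarrow> 'v \<Rightarrow> real" and \<delta> s \<gamma> :: real
    and sub :: "'v subroutine"
  assumes program: "period_program sub V d s (length reqs) (\<lambda>i. node (reqs ! i)) 1 \<gamma> \<Gamma>"
    and fast: "2 \<le> s"
    and windows: "\<forall>x \<in> set reqs. three_full_periods (1/2) \<delta> x"
    and run: "service_run V d reqs 1 R"
  shows "real (profit reqs R) \<le> 2 * \<gamma> * real (profit reqs (fst (speedup sub V d s reqs 1 \<delta> [0, 0, 0, 0])))"
proof (cases "reqs = []")
  case True
  then show ?thesis
    by (simp add: profit_def)
next
  case False
  let ?c = "[0, 0, 0, 0] :: nat list"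
  define n where "n = length reqs"
  define loc where "loc = (\<lambda>i. node (reqs ! i))"
  define tr where "tr = (\<lambda>i. trimmed_period 1 \<delta> ?c (reqs ! i))"
  define k where "k = (\<lambda>i. first_full_period 1 \<delta> (reqs ! i))"
  \<comment> \<open>One visit per served request, with time measured from \<open>\<delta>\<close> so
    that unit periods start at integers.\<close>
  define v where "v = (\<lambda>i. (SOME t. t \<in> window (reqs ! i) \<and> (node (reqs ! i), t) \<in> set R) - \<delta>)"
  define F where "F = {i. i < n \<and> served R (reqs ! i)}"
  define G where "G = (\<lambda>o'. {i \<in> F. of_int (k i) + o' \<le> v i \<and> v i < of_int (k i) + o' + 3/2})"
  define out where "out = profit reqs (fst (speedup sub V d s reqs 1 \<delta> ?c))"
  interpret period_program sub V d s n loc tr 1 \<delta> \<gamma> \<Gamma>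
    unfolding n_def loc_def by (rule program)
  have three: "three_full_periods (1/2) \<delta> (reqs ! i)" if "i < n" for i
    using windows that by (simp add: n_def)
  have tr: "tr i = Some (k i)" if "i < n" for i
    using three_full_periods_unit_grid(1)[OF three[OF that] refl]
    unfolding tr_def k_def trimmed_to_first_period by simp
  have v: "v i + \<delta> \<in> window (reqs ! i)" "(loc i, v i + \<delta>) \<in> set R" if "i \<in> F" for i
  proof -
    have "\<exists>t. t \<in> window (reqs ! i) \<and> (node (reqs ! i), t) \<in> set R"
      using that by (auto simp: F_def served_def)
    from someI_ex[OF this] show "v i + \<delta> \<in> window (reqs ! i)" "(loc i, v i + \<delta>) \<in> set R"
      by (simp_all add: v_def loc_def)
  qed
  have trimmed: "period 1 \<delta> l \<subseteq> window (reqs ! i)" if "i < n" "tr i = Some l" for i l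
    using that tr[OF that(1)] three_full_periods_unit_grid(1)[OF three[OF that(1)] refl]
    by (simp add: period_subset_window_iff k_def)
  have \<gamma>: "1 \<le> \<gamma>"
    using factor_ge_1 False by (simp add: n_def)
  have G: "real (card (G o')) \<le> \<gamma> * real out" for o'
  proof (cases "G o' = {}")
    case True
    then show ?thesis
      using \<gamma> by simp
  next
    case False
    define \<sigma> where "\<sigma> = (\<lambda>i. \<delta> + (of_int (k i) + (v i - of_int (k i) - o') / 2))"
    show ?thesis
      unfolding out_def
    proof (rule speedup_profit[OF program False, where \<sigma> = \<sigma>, folded n_def])
      show "G o' \<subseteq> {..<n}"
        by (auto simp: G_def F_def)
    next
      fix i
      assume "i \<in> G o'"
      then show "\<exists>l. trimmed_period 1 \<delta> ?c (reqs ! i) = Some l \<and> \<sigma> i \<in> period 1 \<delta> l"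
        using tr[of i] unfolding tr_def by (auto simp: G_def F_def \<sigma>_def period_def field_simps)
    next
      fix i j
      assume ij: "i \<in> G o'" "j \<in> G o'" "\<sigma> i \<le> \<sigma> j"
      then have "d (loc i) (loc j) \<le> 1 * \<bar>(v j + \<delta>) - (v i + \<delta>)\<bar>"
        by (intro service_run_dist[OF metric run] v) (auto simp: G_def)
      also have "\<dots> \<le> 2 * (\<sigma> j - \<sigma> i)"
        using sawtooth_speed[of "k i" o' "v i" "k j" "v j"] ij by (auto simp: G_def \<sigma>_def)
      also have "\<dots> \<le> s * (\<sigma> j - \<sigma> i)"
        using ij fast by (intro mult_right_mono) auto
      finally show "d (node (reqs ! i)) (node (reqs ! j)) \<le> s * (\<sigma> j - \<sigma> i)"
        by (simp add: loc_def)
    next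
      fix i l
      assume "i < n" "trimmed_period 1 \<delta> ?c (reqs ! i) = Some l"
      then show "period 1 \<delta> l \<subseteq> window (reqs ! i)"
        using trimmed by (simp add: tr_def)
    qed
  qed
  have "F \<subseteq> G (-1) \<union> G (1/2)"
  proof
    fix i
    assume i: "i \<in> F"
    then have "i < n"
      by (simp add: F_def)
    then have "v i + \<delta> \<in> {\<delta> + of_int (k i) - 1 ..< \<delta> + of_int (k i) + 2}"
      using v(1)[OF i] three_full_periods_unit_grid(2)[OF three refl, of i] by (auto simp: k_def)
    then show "i \<in> G (-1) \<union> G (1/2)"
      using i by (auto simp: G_def)
  qed
  then have "card F \<le> card (G (-1) \<union> G (1/2))"
    by (intro card_mono) (auto simp: G_def F_def)
  also have "\<dots> \<le> card (G (-1)) + card (G (1/2))"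
    by (rule card_Un_le)
  finally have "card F \<le> card (G (-1)) + card (G (1/2))" .
  moreover have "profit reqs R = card F"
    unfolding profit_def length_filter_conv_card F_def n_def ..
  ultimately show ?thesis
    using G[of "-1"] G[of "1/2"] unfolding out_def by linarith
qed

section \<open>The outer loop over grids and trimmings\<close>

lemma profit_Nil: "profit reqs [] = 0"
  by (simp add: profit_def served_def)

lemma fst_better_run:
  "fst (better_run reqs R R') = (if profit reqs R < profit reqs R' then R' else R)"
  by (simp add: better_run_def)

text \<open>Nine grids with 24 trimmings each give \<open>216 = 9 * 24\<close> and
  \<open>225 = 9 * (1 + 24)\<close>. The invariant also bounds the length of the best run, because a
  comparison of two runs is charged by their lengths.\<close>

lemma speedupw12_best:
  fixes sub :: "'v subroutine" and reqs :: "'v request list" and V :: "'v set"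
    and d :: "'v \<Rightarrow> 'v \<Rightarrow> real" and s :: real
  defines "out \<equiv> speedupw12 sub V d s reqs"
  assumes ok: "\<And>\<alpha> \<delta> c. (\<alpha>, \<delta>) \<in> set period_grids \<Longrightarrow> c \<in> set trim_choices \<Longrightarrow>
      Q (fst (speedup sub V d s reqs \<alpha> \<delta> c)) \<and> length (fst (speedup sub V d s reqs \<alpha> \<delta> c)) \<le> length reqs \<and>
      snd (speedup sub V d s reqs \<alpha> \<delta> c) \<le> b"
    and nil: "Q []"
  shows "Q (fst out)"
    and "(\<alpha>, \<delta>) \<in> set period_grids \<Longrightarrow> c \<in> set trim_choices \<Longrightarrow>
      profit reqs (fst (speedup sub V d s reqs \<alpha> \<delta> c)) \<le> profit reqs (fst out)"
    and "snd out \<le> 225 + 216 * (b + 2 * length reqs ^ 2)"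
proof -
  define f where "f = (\<lambda>\<alpha> \<delta> c best. do { R \<leftarrow> speedup sub V d s reqs \<alpha> \<delta> c; better_run reqs best R })"
  have out: "out = loop (\<lambda>(\<alpha>, \<delta>). loop (f \<alpha> \<delta>) trim_choices) period_grids []"
    unfolding out_def speedupw12_def f_def by (simp add: case_prod_unfold)
  have fst_f: "fst (f \<alpha> \<delta> c best) =
      (let R = fst (speedup sub V d s reqs \<alpha> \<delta> c) in if profit reqs best < profit reqs R then R else best)"
    for \<alpha> \<delta> c best
    by (simp add: f_def fst_better_run)
  let ?I = "\<lambda>R. Q R \<and> length R \<le> length reqs"
  have f_ok: "?I (fst (f \<alpha> \<delta> c best)) \<and> snd (f \<alpha> \<delta> c best) \<le> b + 2 * length reqs ^ 2"
    if "(\<alpha>, \<delta>) \<in> set period_grids" "c \<in> set trim_choices" "?I best" for \<alpha> \<delta> c best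
  proof -
    have "length best + length (fst (speedup sub V d s reqs \<alpha> \<delta> c)) \<le> 2 * length reqs"
      using ok[OF that(1,2)] that(3) by linarith
    then have "length reqs * (length best + length (fst (speedup sub V d s reqs \<alpha> \<delta> c))) \<le> 2 * length reqs ^ 2"
      by (metis mult.left_commute mult_le_mono2 power2_eq_square)
    then show ?thesis
      using ok[OF that(1,2)] that(3) by (auto simp: fst_f Let_def) (simp add: f_def better_run_def)
  qed
  have inner_ok: "?I (fst (loop (f \<alpha> \<delta>) trim_choices best))"
    if "(\<alpha>, \<delta>) \<in> set period_grids" "?I best" for \<alpha> \<delta> best
    unfolding fst_loop by (rule fold_preserves[where Q = ?I]) (use that f_ok in auto)
  have "?I (fst out)"
    unfolding out fst_loop
    by (rule fold_preserves[where Q = ?I]) (use inner_ok nil in \<open>auto simp del: fst_loop\<close>)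
  then show "Q (fst out)"
    by blast
  show "profit reqs (fst (speedup sub V d s reqs \<alpha> \<delta> c)) \<le> profit reqs (fst out)"
    if "(\<alpha>, \<delta>) \<in> set period_grids" "c \<in> set trim_choices"
  proof -
    let ?Q = "\<lambda>R. profit reqs (fst (speedup sub V d s reqs \<alpha> \<delta> c)) \<le> profit reqs R"
    have mono: "?Q (fst (loop (f \<alpha>' \<delta>') cs best))" if "?Q best" for \<alpha>' \<delta>' cs best
      unfolding fst_loop
      by (rule fold_preserves[where Q = ?Q]) (use that in \<open>auto simp: fst_f Let_def\<close>)
    have reach: "?Q (fst (loop (f \<alpha> \<delta>) trim_choices best))" for best
      unfolding fst_loop
      by (rule fold_reaches[OF that(2), where Q = ?Q]) (auto simp: fst_f Let_def)
    show ?thesis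
      unfolding out fst_loop[of "\<lambda>(\<alpha>, \<delta>). loop (f \<alpha> \<delta>) trim_choices"]
      by (rule fold_reaches[OF that(1), where Q = ?Q]) (use mono reach in \<open>auto simp del: fst_loop\<close>)
  qed
  have "length trim_choices = 24" "length period_grids = 9"
    by (simp_all add: trim_choices_def period_grids_def)
  have "snd (loop (f \<alpha> \<delta>) trim_choices best) \<le> 24 * (1 + (b + 2 * length reqs ^ 2))"
    if "(\<alpha>, \<delta>) \<in> set period_grids" "?I best" for \<alpha> \<delta> best
    using snd_loop_invariant[where I = ?I and xs = trim_choices and f = "f \<alpha> \<delta>"
        and b = "b + 2 * length reqs ^ 2"] that f_ok \<open>length trim_choices = 24\<close> by metis
  then have "snd out \<le> length period_grids * (1 + 24 * (1 + (b + 2 * length reqs ^ 2)))"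
    unfolding out
    by (intro snd_loop_invariant[where I = ?I]) (use inner_ok nil in \<open>auto simp del: fst_loop\<close>)
  then show "snd out \<le> 225 + 216 * (b + 2 * length reqs ^ 2)"
    using \<open>length period_grids = 9\<close> by simp
qed

section \<open>Positive profit, the numerical ratio and the final estimate\<close>

lemma optimal_run_profit_pos:
  assumes "optimal_run V d reqs 1 R" "node ` set reqs \<subseteq> V" "\<forall>x \<in> set reqs. window x \<noteq> {}"
  shows "profit reqs R > 0"
proof -
  have "fst (hd R) \<in> node ` set reqs"
    using assms(1) by (auto simp: optimal_run_def service_run_def)
  then obtain x where x: "x \<in> set reqs"
    by blast
  then obtain t where t: "t \<in> window x"
    using assms(3) by auto
  \<comment> \<open>A single stop at one request during its window involves no travel.\<close>
  have "service_run V d reqs 1 [(node x, t)]"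
    using x assms(2) by (auto simp: service_run_def)
  then have "profit reqs [(node x, t)] \<le> profit reqs R"
    using assms(1) by (simp add: optimal_run_def)
  moreover have "served [(node x, t)] x"
    using t by (auto simp: served_def)
  then have "0 < profit reqs [(node x, t)]"
    using x by (auto simp: profit_def filter_empty_conv)
  ultimately show ?thesis
    by linarith
qed

text \<open>The denominator is \<open>1 + s * (3 - s)\<close>, hence positive. Clearing it leaves
  \<open>(7 - 2 * s) * (3 - s) \<ge> 0\<close>, with equality at \<open>s = 3\<close>.\<close>

lemma ratio_bound:
  fixes s :: real
  assumes "17/7 \<le> s" "s \<le> 3"
  shows "2 \<le> (23 - 7 * s) / (1 + 3 * s - s\<^sup>2)"
proof -
  have "0 \<le> s * (3 - s)" "0 \<le> (7 - 2 * s) * (3 - s)"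
    using assms by simp_all
  then show ?thesis
    by (simp add: pos_le_divide_eq algebra_simps power2_eq_square)
qed

text \<open>This allows the factor \<open>min r m\<close> to be inserted into a bound by
  \<open>\<Gamma>\<close> alone. Finiteness matters because \<open>card\<close> of an infinite set
  is 0.\<close>

lemma num_periods_pos:
  assumes "x \<in> set reqs" "three_full_periods (1/2) \<delta> x"
  shows "1 \<le> num_periods (1/2) \<delta> c reqs"
proof -
  obtain a where "period (1/2) \<delta> a \<subseteq> window x"
    using assms(2) unfolding three_full_periods_def by blast
  then have "num_full_periods (1/2) \<delta> x \<noteq> 0"
    by (auto simp: period_subset_window_iff)
  then have "{i. \<exists>x \<in> set reqs. trimmed_period (1/2) \<delta> c x = Some i} \<noteq> {}"
    using assms(1) by (auto simp: trimmed_period_def Let_def)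
  moreover have "{i. \<exists>x \<in> set reqs. trimmed_period (1/2) \<delta> c x = Some i} \<subseteq>
      (\<lambda>x. the (trimmed_period (1/2) \<delta> c x)) ` set reqs"
    by force
  then have "finite {i. \<exists>x \<in> set reqs. trimmed_period (1/2) \<delta> c x = Some i}"
    by (rule finite_subset) simp
  ultimately have "0 < num_periods (1/2) \<delta> c reqs"
    unfolding num_periods_def card_gt_0_iff by blast
  then show ?thesis
    by simp
qed

theorem theorem7:
  fixes \<N> :: "('v set \<times> ('v \<Rightarrow> 'v \<Rightarrow> real)) set"
    and \<gamma> :: real
    and \<Gamma> :: "nat \<Rightarrow> nat"
    and sub :: "'v subroutine"
  assumes networks: "\<forall>(V, d) \<in> \<N>. metric_graph V d"
    and subroutine: "path_subroutine \<N> \<gamma> \<Gamma> sub"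
    and time_bound: "running_time_bound \<Gamma>"
  shows "\<exists>C :: real.
    \<forall>V d (reqs :: 'v request list) \<delta> (q :: nat) (r :: nat) (s :: real) c Ropt.
      (V, d) \<in> \<N> \<and> node ` set reqs \<subseteq> V \<and>
      unit_speed_is_reference V d reqs \<and>
      (1/2, \<delta>) \<in> set period_grids \<and>
      (\<forall>x \<in> set reqs. three_full_periods (1/2) \<delta> x) \<and>
      c \<in> set trim_choices \<and>
      r > 0 \<and> s = real q / real r \<and> 17/7 \<le> s \<and> s \<le> 3 \<and>
      optimal_run V d reqs 1 Ropt \<longrightarrow>
      (case speedupw12 sub V d s reqs of (Rhat, steps) \<Rightarrow>
         service_run V d reqs s Rhat \<and>
         profit reqs Rhat > 0 \<and>
         real (profit reqs Ropt) / real (profit reqs Rhat) \<le> \<gamma> * (23 - 7 * s) / (1 + 3 * s - s\<^sup>2) \<and>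
         real steps \<le> C * real (min r (num_periods (1/2) \<delta> c reqs)) * real (\<Gamma> (length reqs)))"
proof -
  have main: "service_run V d reqs s (fst out) \<and> profit reqs (fst out) > 0 \<and>
      real (profit reqs Ropt) / real (profit reqs (fst out)) \<le> \<gamma> * (23 - 7 * s) / (1 + 3 * s - s\<^sup>2) \<and>
      real (snd out) \<le> 6000 * real (min r (num_periods (1/2) \<delta> c reqs)) * real (\<Gamma> (length reqs))"
    if "(V, d) \<in> \<N>" and V: "node ` set reqs \<subseteq> V" and \<delta>: "(1/2, \<delta>) \<in> set period_grids"
      and windows: "\<forall>x \<in> set reqs. three_full_periods (1/2) \<delta> x"
      and "r > 0" and s: "17/7 \<le> s" "s \<le> 3" and opt: "optimal_run V d reqs 1 Ropt"
      and out: "out = speedupw12 sub V d s reqs"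
    for V d and reqs :: "'v request list" and \<delta> s :: real and r :: nat and c Ropt out
  proof -
    let ?n = "length reqs"
    have metric: "Metric_space V d"
      using networks that(1) by (auto simp: metric_graph_def)
    have program: "period_program sub V d s ?n (\<lambda>i. node (reqs ! i)) \<alpha> \<gamma> \<Gamma>" if "\<alpha> > 0" for \<alpha>
    proof (rule period_program.intro)
      show "Metric_space V d" "0 < s" "0 < \<alpha>"
        using metric s that by simp_all
      show "(\<lambda>i. node (reqs ! i)) ` {..<?n} \<subseteq> V"
        using V by auto
      show "max_profit_paths \<gamma> d (\<lambda>i. node (reqs ! i)) (set S) (fst (sub V d (\<lambda>i. node (reqs ! i)) S)) \<and>
          snd (sub V d (\<lambda>i. node (reqs ! i)) S) \<le> \<Gamma> (length S)"
        if "distinct S" "(\<lambda>i. node (reqs ! i)) ` set S \<subseteq> V" for S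
        using subroutine \<open>(V, d) \<in> \<N>\<close> that unfolding path_subroutine_def by blast
    qed
    obtain x where x: "x \<in> set reqs"
      using opt by (auto simp: optimal_run_def service_run_def)
    then have n: "?n > 0"
      by auto
    have grids: "\<alpha> > 0" if "(\<alpha>, \<delta>) \<in> set period_grids" for \<alpha> \<delta>
      using that by (auto simp: period_grids_def)
    have each: "(fst (speedup sub V d s reqs \<alpha> \<delta> c) = [] \<or> service_run V d reqs s (fst (speedup sub V d s reqs \<alpha> \<delta> c))) \<and>
        length (fst (speedup sub V d s reqs \<alpha> \<delta> c)) \<le> ?n \<and> snd (speedup sub V d s reqs \<alpha> \<delta> c) \<le> 23 * \<Gamma> ?n"
      if "(\<alpha>, \<delta>) \<in> set period_grids" for \<alpha> \<delta> c
    proof -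
      note p = program[OF grids[OF that]]
      show ?thesis
        using speedup_service_run[OF p] speedup_length[OF p] speedup_time[OF p time_bound n] by blast
    qed
    note best = speedupw12_best[where Q = "\<lambda>R. R = [] \<or> service_run V d reqs s R" and b = "23 * \<Gamma> ?n"
        and sub = sub and V = V and d = d and s = s and reqs = reqs, folded out]
    have sound: "fst out = [] \<or> service_run V d reqs s (fst out)"
      by (rule best(1)) (use each in blast)+
    \<comment> \<open>The offsets 0 and 1/4 of the half grid also occur with period length
      1.\<close>
    have "(1, \<delta>) \<in> set period_grids" "[0, 0, 0, 0] \<in> set trim_choices"
      using \<delta> by (auto simp: period_grids_def trim_choices_def)
    then have "profit reqs (fst (speedup sub V d s reqs 1 \<delta> [0, 0, 0, 0])) \<le> profit reqs (fst out)"
      by (intro best(2)) (use each in blast)+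
    moreover have "real (profit reqs Ropt) \<le>
        2 * \<gamma> * real (profit reqs (fst (speedup sub V d s reqs 1 \<delta> [0, 0, 0, 0])))"
      by (rule speedup_half[OF program _ windows]) (use opt s in \<open>auto simp: optimal_run_def\<close>)
    moreover have \<gamma>: "1 \<le> \<gamma>"
      using period_program.factor_ge_1[OF program[of 1]] n by simp
    ultimately have half: "real (profit reqs Ropt) \<le> 2 * \<gamma> * real (profit reqs (fst out))"
      by (smt (verit) mult_left_mono of_nat_mono)
    have "window x \<noteq> {}" if "x \<in> set reqs" for x
      using windows that unfolding three_full_periods_def partially_overlaps_def by blast
    then have "profit reqs Ropt > 0"
      using optimal_run_profit_pos[OF opt V] by blast
    then have pos: "profit reqs (fst out) > 0"
      using half by (cases "profit reqs (fst out) = 0") auto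
    have "real (profit reqs Ropt) / real (profit reqs (fst out)) \<le> \<gamma> * 2"
      using half pos by (simp add: field_simps)
    also have "\<dots> \<le> \<gamma> * ((23 - 7 * s) / (1 + 3 * s - s\<^sup>2))"
      using \<gamma> ratio_bound[OF s] by (intro mult_left_mono) auto
    finally have ratio: "real (profit reqs Ropt) / real (profit reqs (fst out)) \<le>
        \<gamma> * (23 - 7 * s) / (1 + 3 * s - s\<^sup>2)"
      by simp
    have cost: "snd out \<le> 225 + 216 * (23 * \<Gamma> ?n + 2 * ?n ^ 2)"
      by (rule best(3)) (use each in blast)+
    have "?n ^ 4 \<le> \<Gamma> ?n"
      using time_bound by (simp add: running_time_bound_def)
    moreover have "?n ^ 2 \<le> ?n ^ 4" "0 < ?n ^ 4"
      using n power_increasing[of 2 4 ?n] by (simp_all add: Suc_le_eq)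
    ultimately have "?n ^ 2 \<le> \<Gamma> ?n" "1 \<le> \<Gamma> ?n"
      by linarith+
    \<comment> \<open>\<open>225 + 216 * (23 + 2) = 5625\<close>, rounded up.\<close>
    then have "snd out \<le> 6000 * \<Gamma> ?n"
      using cost by (simp add: algebra_simps)
    also have "\<dots> = 6000 * 1 * \<Gamma> ?n"
      by simp
    also have "\<dots> \<le> 6000 * min r (num_periods (1/2) \<delta> c reqs) * \<Gamma> ?n"
      using num_periods_pos[OF x] windows x \<open>r > 0\<close> by (intro mult_le_mono) auto
    finally have "real (snd out) \<le> real (6000 * min r (num_periods (1/2) \<delta> c reqs) * \<Gamma> ?n)"
      by (rule of_nat_mono)
    then have "real (snd out) \<le> 6000 * real (min r (num_periods (1/2) \<delta> c reqs)) * real (\<Gamma> ?n)"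
      by (simp only: of_nat_mult of_nat_numeral)
    moreover have "fst out \<noteq> []"
      using pos by (auto simp: profit_Nil)
    ultimately show ?thesis
      using sound pos ratio by auto
  qed
  show ?thesis
  proof (intro exI[of _ 6000] allI impI, elim conjE)
    fix V d and reqs :: "'v request list" and \<delta> s :: real and q r :: nat and c Ropt
    assume "(V, d) \<in> \<N>" "node ` set reqs \<subseteq> V" "(1/2, \<delta>) \<in> set period_grids"
      "\<forall>x \<in> set reqs. three_full_periods (1/2) \<delta> x" "r > 0" "17/7 \<le> s" "s \<le> 3"
      "optimal_run V d reqs 1 Ropt"
    from main[OF this refl, of c]
    show "case speedupw12 sub V d s reqs of (Rhat, steps) \<Rightarrow>
         service_run V d reqs s Rhat \<and>
         profit reqs Rhat > 0 \<and>
         real (profit reqs Ropt) / real (profit reqs Rhat) \<le> \<gamma> * (23 - 7 * s) / (1 + 3 * s - s\<^sup>2) \<and>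
         real steps \<le> 6000 * real (min r (num_periods (1/2) \<delta> c reqs)) * real (\<Gamma> (length reqs))"
      by (simp only: case_prod_unfold)
  qed
qed

end
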